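(* Let $T>0$, $0<\eta<T$, $0<\alpha <\frac{2T}{\eta ^{2}}$ and $0\leq\beta < \frac{2T-\alpha \eta ^{2}}{\alpha \eta ^{2}-2\eta +2T}$. Assume $f\in C([0,\infty),[0,\infty))$, and $a\in C([0,T],[0,\infty))$ with $a(t_0)>0$ for some $t_{0}\in[\eta,T]$. Let \[ f_{0}=\lim_{u\rightarrow0^{+}}\frac{f(u)}{u},\qquad f_{\infty}=\lim_{u\rightarrow\infty}\frac{f(u)}{u}. \] Then the boundary value problem \[ u''(t)+a(t)f(u(t))=0,\ 0<t<T,\qquad u(0)=\beta u(\eta),\quad u(T)=\alpha\int_{0}^{\eta}u(s)\,ds \] has at least one positive solution in each of the following cases: (i) $f_{0}=0$ and $f_{\infty}=\infty$ (superlinear case); (ii) $f_{0}=\infty$ and $f_{\infty}=0$ (sublinear case).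
   Context: A solution is a function $u\in C^2([0,T])$ satisfying the differential equation on $(0,T)$ and the boundary conditions; a positive solution is a solution $u$ with $u(t)>0$ for $0<t<T$. The limits defining $f_0$ and $f_\infty$ are assumed to exist (possibly infinite) with the stated values. *)

theory Defs
  imports "HOL-Analysis.Analysis"
begin

definition C2_on :: "real \<Rightarrow> (real \<Rightarrow> real) \<Rightarrow> (real \<Rightarrow> real) \<Rightarrow> (real \<Rightarrow> real) \<Rightarrow> bool" where
  "C2_on T u u' u'' \<longleftrightarrow>
     (\<forall>t\<in>{0..T}. (u has_real_derivative u' t) (at t within {0..T})) \<and>
     (\<forall>t\<in>{0..T}. (u' has_real_derivative u'' t) (at t within {0..T})) \<and>
     continuous_on {0..T} u''"

definition is_solution ::
  "real \<Rightarrow> real \<Rightarrow> real \<Rightarrow> real \<Rightarrow> (real \<Rightarrow> real) \<Rightarrow> (real \<Rightarrow> real) \<Rightarrow> (real \<Rightarrow> real) \<Rightarrow> bool" where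
  "is_solution T \<eta> \<alpha> \<beta> a f u \<longleftrightarrow>
     (\<exists>u' u''. C2_on T u u' u'' \<and> (\<forall>t\<in>{0<..<T}. u'' t + a t * f (u t) = 0)) \<and>
     u 0 = \<beta> * u \<eta> \<and> u T = \<alpha> * integral {0..\<eta>} u"

end

(* Writing G for the Green function of the boundary value problem, the task is to find a non-zero
   non-negative y with y = a f(G y). Everything rests on the two-sided bound
   c(t) m(s) <= G(t,s) <= C m(s), where m(s) = s (T - s) and c(t) > 0 on (0,T): if u = G y, then u
   lies between c rho and C rho, where rho is the integral of m y. Discretise by midpoint sums,
   and split the unknown into its size rho and its shape x in a simplex. With F the discretised
   right-hand side and |.| the sum of the entries, apply Brouwer's theorem to
   (rho, x) |-> (clip (rho +- (|F(rho x)| - rho)), (x + F(rho x)) / (1 + |F(rho x)|)).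
   A fixed point satisfies F(rho x) = |F(rho x)| x, and the growth of f at 0 and at infinity
   excludes that rho is at an end of the interval, so |F(rho x)| = rho. The sign is chosen according
   to the superlinear or sublinear case. As the bounds do not depend on the mesh, Arzela-Ascoli
   gives a solution in the limit. *)

theory Submission
  imports Defs "HOL-Complex_Analysis.Great_Picard"
begin

section \<open>Brouwer in a cone of variable dimension\<close>

text \<open>The obstacle is the trivial solution: in case (i) continuity forces f(0) = 0, so 0 is
  itself a fixed point, and a fixed point theorem on a full ball of the cone could return it. Hence
  the size rho is kept above a number r that is the same for all meshes; the limit then satisfies
  u(t) >= r c(t), which is positive inside the interval. The second difficulty is that c(t) vanishes
  at 0 and T, so a large rho does not make u large everywhere. The growth of f at infinity is
  therefore turned into linear bounds valid for all u >= 0, namely f(u) >= M (u - U) or f(u) <= e u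
  + K. Integrated against a m, the first one gains a multiple of the integral of a m c, which is
  positive, and loses only a constant, which a large rho absorbs.\<close>

lemma compact_nat_cube:
  "compact {x :: nat \<Rightarrow> real. \<forall>i. x i \<in> (if i < n then {0..1} else {0})}" (is "compact ?S")
proof -
  have "compactin (product_topology (\<lambda>i. euclidean) UNIV)
          (PiE UNIV (\<lambda>i. if i < n then {0..1::real} else {0}))"
    by (subst compactin_PiE) auto
  moreover have "PiE UNIV (\<lambda>i. if i < n then {0..1::real} else {0}) = ?S"
    unfolding PiE_UNIV_domain Pi_def by blast
  ultimately show ?thesis
    by (simp only: euclidean_product_topology compactin_euclidean_iff)
qed

lemma tendsto_fun_iff:
  fixes X :: "'c \<Rightarrow> 'a \<Rightarrow> 'b::topological_space"
  shows "(X \<longlongrightarrow> x) F \<longleftrightarrow> (\<forall>i. ((\<lambda>k. X k i) \<longlongrightarrow> x i) F)"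
  using limitin_componentwise[of "\<lambda>_. euclidean" UNIV X x F]
  by (simp add: euclidean_product_topology)

text \<open>The dimension is a number here and not a type, as it has to vary in the discretisation.\<close>

lemma brouwer_nat_cube:
  fixes F :: "(nat \<Rightarrow> real) \<Rightarrow> nat \<Rightarrow> real" and n :: nat
  defines "S \<equiv> {x. \<forall>i. x i \<in> (if i < n then {0..1} else {0})}"
  assumes cont: "\<And>i. i < n \<Longrightarrow> continuous_on S (\<lambda>x. F x i)"
    and bounds: "\<And>x i. x \<in> S \<Longrightarrow> i < n \<Longrightarrow> F x i \<in> {0..1}"
  obtains x where "x \<in> S" "\<And>i. i < n \<Longrightarrow> F x i = x i"
proof -
  define emb :: "nat \<Rightarrow> (nat \<Rightarrow> nat) \<Rightarrow> nat \<Rightarrow> real"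
    where "emb p x = (\<lambda>i. if i < n then x i / p else 0)" for p x
  have emb_S: "emb p x \<in> S" if "p > 0" "\<forall>i<n. x i \<le> p" for p x
    using that by (auto simp: emb_def S_def)
  \<comment> \<open>Label 0 marks a coordinate that \<open>F\<close> does not decrease, label 1 one
    that it does not increase. The faces come first because Kuhn's lemma prescribes the labels
    there; \<open>bounds\<close> makes this consistent.\<close>
  define label :: "nat \<Rightarrow> (nat \<Rightarrow> nat) \<Rightarrow> nat \<Rightarrow> nat"
    where "label p x i = (if x i = p then 1 else if x i = 0 then 0
      else if emb p x i \<le> F (emb p x) i then 0 else 1)" for p x i
  have label0: "emb p x i \<le> F (emb p x) i"
    if "p > 0" "\<forall>i<n. x i \<le> p" "i < n" "label p x i = 0" for p x i
    using that bounds[OF emb_S[OF that(1,2)] that(3)]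
    by (auto simp: label_def emb_def split: if_splits)
  have label1: "F (emb p x) i \<le> emb p x i"
    if "p > 0" "\<forall>i<n. x i \<le> p" "i < n" "label p x i \<noteq> 0" for p x i
    using that bounds[OF emb_S[OF that(1,2)] that(3)]
    by (auto simp: label_def emb_def split: if_splits)
  define box where "box q x \<longleftrightarrow> (\<forall>j<n. q j \<le> x j \<and> x j \<le> q j + 1)" for q x :: "nat \<Rightarrow> nat"
  define below where "below p x \<longleftrightarrow> (\<forall>j<n. x j \<le> p)" for p and x :: "nat \<Rightarrow> nat"
  have "\<exists>q A B. below p q \<and> (\<forall>i<n. below p (A i) \<and> below p (B i) \<and> box q (A i) \<and> box q (B i) \<and>
      label p (A i) i = 0 \<and> label p (B i) i \<noteq> 0)" if p: "p > 0" for p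
  proof (rule kuhn_lemma[OF p, of n "label p"])
    fix q assume q: "\<forall>i<n. q i < p"
      "\<forall>i<n. \<exists>r s. (\<forall>j<n. q j \<le> r j \<and> r j \<le> q j + 1) \<and> (\<forall>j<n. q j \<le> s j \<and> s j \<le> q j + 1)
          \<and> label p r i \<noteq> label p s i"
    have lab: "label p r i = 0 \<or> label p r i = 1" for r i by (simp add: label_def)
    have box_below: "below p x" if "box q x" for x
      using that q(1) unfolding box_def below_def by (metis Suc_eq_plus1 Suc_leI le_trans)
    have "\<exists>A B. box q A \<and> box q B \<and> label p A i = 0 \<and> label p B i \<noteq> 0" if "i < n" for i
      using q(2)[rule_format, OF that] lab unfolding box_def[symmetric] by metis
    then obtain A B where "\<And>i. i < n \<Longrightarrow> box q (A i) \<and> box q (B i) \<and> label p (A i) i = 0 \<and> label p (B i) i \<noteq> 0"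
      by metis
    moreover from this have "below p (A i)" "below p (B i)" if "i < n" for i
      using that box_below by blast+
    moreover have "below p q" using q(1) by (auto simp: below_def)
    ultimately show ?thesis by blast
  qed (use p in \<open>auto simp: label_def\<close>)
  then obtain q A B where below_q: "\<And>p. p > 0 \<Longrightarrow> below p (q p)"
    and AB: "\<And>p i. p > 0 \<Longrightarrow> i < n \<Longrightarrow> below p (A p i) \<and> below p (B p i) \<and> box (q p) (A p i) \<and> box (q p) (B p i) \<and>
      label p (A p i) i = 0 \<and> label p (B p i) i \<noteq> 0"
    by metis
  \<comment> \<open>\<open>Suc p\<close> keeps the mesh parameter positive, as \<open>emb\<close>
    divides by it.\<close>
  define z where "z p = emb (Suc p) (q (Suc p))" for p
  have "seq_compact S"
    using compact_nat_cube[of n] compact_eq_seq_compact_metric unfolding S_def by blast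
  moreover have "\<forall>p. z p \<in> S" unfolding z_def using below_q by (intro allI emb_S) (auto simp: below_def)
  ultimately obtain x k where x: "x \<in> S" and k: "strict_mono k" and lim: "(z \<circ> k) \<longlonglongrightarrow> x"
    by (rule seq_compactE)
  \<comment> \<open>Points of a cell differ from its corner by at most \<open>1 / p\<close> in each
    coordinate, so every choice of vertices has the same limit. This matters because the vertices
    \<open>A p i\<close> and \<open>B p i\<close> vary with the coordinate \<open>i\<close>.\<close>
  have close: "(\<lambda>m. emb (Suc (k m)) (C (Suc (k m)))) \<longlonglongrightarrow> x"
    if C: "\<And>p. p > 0 \<Longrightarrow> box (q p) (C p)" for C
  proof (unfold tendsto_fun_iff, rule allI)
    fix j
    have zj: "(\<lambda>m. z (k m) j) \<longlonglongrightarrow> x j"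
      using lim[unfolded tendsto_fun_iff, rule_format, of j] by (simp add: o_def)
    have inv: "(\<lambda>m. 1 / real (Suc (k m))) \<longlonglongrightarrow> 0"
      using LIMSEQ_subseq_LIMSEQ[OF lim_1_over_n[THEN LIMSEQ_Suc] k] by (simp add: o_def)
    show "(\<lambda>m. emb (Suc (k m)) (C (Suc (k m))) j) \<longlonglongrightarrow> x j"
    proof (rule tendsto_sandwich[OF _ _ zj])
      show "(\<lambda>m. z (k m) j + 1 / real (Suc (k m))) \<longlonglongrightarrow> x j"
        using tendsto_add[OF zj inv] by simp
      show "\<forall>\<^sub>F m in sequentially. z (k m) j \<le> emb (Suc (k m)) (C (Suc (k m))) j"
        using C by (intro always_eventually allI) (auto simp: z_def emb_def box_def intro!: divide_right_mono)
      show "\<forall>\<^sub>F m in sequentially. emb (Suc (k m)) (C (Suc (k m))) j \<le> z (k m) j + 1 / real (Suc (k m))"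
      proof (intro always_eventually allI)
        fix m
        show "emb (Suc (k m)) (C (Suc (k m))) j \<le> z (k m) j + 1 / real (Suc (k m))"
        proof (cases "j < n")
          case True
          then have "real (C (Suc (k m)) j) \<le> real (q (Suc (k m)) j) + 1"
            using C[of "Suc (k m)"] unfolding box_def by (metis of_nat_1 of_nat_add of_nat_le_iff zero_less_Suc)
          then show ?thesis
            using True by (simp add: z_def emb_def add_divide_distrib[symmetric] divide_right_mono del: of_nat_Suc)
        qed (simp add: z_def emb_def)
      qed
    qed
  qed
  have fixp: "F x i = x i" if i: "i < n" for i
  proof (rule antisym)
    have FC: "(\<lambda>m. F (emb (Suc (k m)) (C (Suc (k m)))) i) \<longlonglongrightarrow> F x i"
      if "(\<lambda>m. emb (Suc (k m)) (C (Suc (k m)))) \<longlonglongrightarrow> x" "\<And>p. p > 0 \<Longrightarrow> below p (C p)" for C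
      by (rule continuous_on_tendsto_compose[OF cont[OF i] that(1) x])
         (use that(2) in \<open>auto intro!: always_eventually emb_S simp: below_def\<close>)
    have A: "(\<lambda>m. emb (Suc (k m)) (A (Suc (k m)) i)) \<longlonglongrightarrow> x"
      by (rule close) (use AB i in blast)
    have B: "(\<lambda>m. emb (Suc (k m)) (B (Suc (k m)) i)) \<longlonglongrightarrow> x"
      by (rule close) (use AB i in blast)
    \<comment> \<open>Vertices with label 1 yield this inequality in the limit, those with label 0
      the reverse one.\<close>
    show "F x i \<le> x i"
      by (rule LIMSEQ_le[OF FC[of "\<lambda>p. B p i", OF B] B[unfolded tendsto_fun_iff, rule_format]])
         (use AB i in \<open>auto simp: below_def intro!: exI label1\<close>)
    show "x i \<le> F x i"
      by (rule LIMSEQ_le[OF A[unfolded tendsto_fun_iff, rule_format] FC[of "\<lambda>p. A p i", OF A]])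
         (use AB i in \<open>auto simp: below_def intro!: exI label0\<close>)
  qed
  show thesis by (rule that[OF x fixp])
qed

text \<open>Krasnosel'skii's theorem in finite dimension, for the cone of non-negative vectors with
  the sum of the entries as norm. The two alternatives in \<open>bdry\<close> are expansion and
  compression of the cone.\<close>

lemma cone_fixed_point_finite:
  fixes F :: "(nat \<Rightarrow> real) \<Rightarrow> nat \<Rightarrow> real" and n :: nat and r R :: real
  assumes n: "0 < n" and r: "0 < r" "r < R"
    and cont: "\<And>i. i < n \<Longrightarrow> continuous_on {x. \<forall>i. 0 \<le> x i} (\<lambda>x. F x i)"
    and nonneg: "\<And>x i. \<forall>i. 0 \<le> x i \<Longrightarrow> i < n \<Longrightarrow> 0 \<le> F x i"
    and bdry: "((\<forall>x. (\<forall>i. 0 \<le> x i) \<and> (\<Sum>i<n. x i) = r \<longrightarrow> (\<Sum>i<n. F x i) < r) \<and>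
                (\<forall>x. (\<forall>i. 0 \<le> x i) \<and> (\<Sum>i<n. x i) = R \<longrightarrow> R < (\<Sum>i<n. F x i))) \<or>
               ((\<forall>x. (\<forall>i. 0 \<le> x i) \<and> (\<Sum>i<n. x i) = r \<longrightarrow> r < (\<Sum>i<n. F x i)) \<and>
                (\<forall>x. (\<forall>i. 0 \<le> x i) \<and> (\<Sum>i<n. x i) = R \<longrightarrow> (\<Sum>i<n. F x i) < R))"
  obtains x where "\<And>i. 0 \<le> x i" "r \<le> (\<Sum>i<n. x i)" "(\<Sum>i<n. x i) \<le> R" "\<And>i. i < n \<Longrightarrow> F x i = x i"
proof -
  \<comment> \<open>With the sign \<open>s\<close> both alternatives say the same: the drift of the
    size points into the interval at either end.\<close>
  obtain s :: real where s:
    "\<And>x. \<forall>i. 0 \<le> x i \<Longrightarrow> (\<Sum>i<n. x i) = r \<Longrightarrow> s * ((\<Sum>i<n. F x i) - r) > 0"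
    "\<And>x. \<forall>i. 0 \<le> x i \<Longrightarrow> (\<Sum>i<n. x i) = R \<Longrightarrow> s * ((\<Sum>i<n. F x i) - R) < 0"
    using bdry
  proof
    assume "(\<forall>x. (\<forall>i. 0 \<le> x i) \<and> (\<Sum>i<n. x i) = r \<longrightarrow> (\<Sum>i<n. F x i) < r) \<and>
                (\<forall>x. (\<forall>i. 0 \<le> x i) \<and> (\<Sum>i<n. x i) = R \<longrightarrow> R < (\<Sum>i<n. F x i))"
    then show thesis by (intro that[of "-1"]) auto
  next
    assume "(\<forall>x. (\<forall>i. 0 \<le> x i) \<and> (\<Sum>i<n. x i) = r \<longrightarrow> r < (\<Sum>i<n. F x i)) \<and>
                (\<forall>x. (\<forall>i. 0 \<le> x i) \<and> (\<Sum>i<n. x i) = R \<longrightarrow> (\<Sum>i<n. F x i) < R)"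
    then show thesis by (intro that[of 1]) auto
  qed
  \<comment> \<open>The first \<open>n\<close> coordinates carry the shape; coordinate
    \<open>n\<close> is the relative position of the size between \<open>r\<close> and
    \<open>R\<close>.\<close>
  define S where "S = {x :: nat \<Rightarrow> real. \<forall>i. x i \<in> (if i < Suc n then {0..1} else {0})}"
  have S_nonneg: "0 \<le> z i" if "z \<in> S" for z i
    using that unfolding S_def by (cases "i < Suc n") (force split: if_splits)+
  have S_n: "z n \<in> {0..1}" if "z \<in> S" for z
    using that unfolding S_def by (force split: if_splits)
  define \<sigma> where "\<sigma> z = (\<Sum>i<n. z i)" for z :: "nat \<Rightarrow> real"
  \<comment> \<open>\<open>\<nu>\<close> retracts the cube onto the simplex.\<close>
  define \<nu> where "\<nu> z i = (z i + max 0 (1 - \<sigma> z) / n) / max 1 (\<sigma> z)" for z :: "nat \<Rightarrow> real" and i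
  define \<rho> where "\<rho> z = r + (R - r) * z n" for z :: "nat \<Rightarrow> real"
  define y where "y z i = \<rho> z * \<nu> z i" for z :: "nat \<Rightarrow> real" and i
  define \<mu> where "\<mu> z = (\<Sum>i<n. F (y z) i)" for z :: "nat \<Rightarrow> real"
  \<comment> \<open>Adding \<open>\<nu> z\<close> keeps the denominator at least 1 even where
    \<open>F\<close> vanishes, and a fixed point is still parallel to its image under
    \<open>F\<close>.\<close>
  define \<Phi> where "\<Phi> z i = (if i < n then (\<nu> z i + F (y z) i) / (1 + \<mu> z)
      else max 0 (min 1 (z n + s * (\<mu> z - \<rho> z))))" for z :: "nat \<Rightarrow> real" and i
  have \<nu>_nonneg: "0 \<le> \<nu> z i" if "z \<in> S" for z i
    using S_nonneg[OF that] by (auto simp: \<nu>_def)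
  have \<nu>_sum: "(\<Sum>i<n. \<nu> z i) = 1" for z
  proof -
    have "(\<Sum>i<n. \<nu> z i) = (\<sigma> z + n * (max 0 (1 - \<sigma> z) / n)) / max 1 (\<sigma> z)"
      by (simp add: \<nu>_def sum_divide_distrib[symmetric] sum.distrib \<sigma>_def)
    then show ?thesis using n by (auto simp: max_def)
  qed
  have \<rho>_ge: "r \<le> \<rho> z" "\<rho> z \<le> R" if "z \<in> S" for z
  proof -
    have "(R - r) * z n \<le> (R - r) * 1" "0 \<le> (R - r) * z n"
      using S_n[OF that] r by (intro mult_left_mono mult_nonneg_nonneg; simp)+
    then show "r \<le> \<rho> z" "\<rho> z \<le> R" by (auto simp: \<rho>_def)
  qed
  have y_nonneg: "\<forall>i. 0 \<le> y z i" if "z \<in> S" for z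
    using \<nu>_nonneg[OF that] \<rho>_ge[OF that] r by (auto simp: y_def intro!: mult_nonneg_nonneg)
  have F_nonneg: "0 \<le> F (y z) i" if "z \<in> S" "i < n" for z i
    using nonneg[OF y_nonneg] that by blast
  have \<mu>_nonneg: "0 \<le> \<mu> z" if "z \<in> S" for z
    unfolding \<mu>_def using F_nonneg[OF that] by (intro sum_nonneg) auto
  have \<Phi>_sum: "(\<Sum>i<n. \<Phi> z i) = 1" if "z \<in> S" for z
  proof -
    have "(\<Sum>i<n. \<Phi> z i) = ((\<Sum>i<n. \<nu> z i) + \<mu> z) / (1 + \<mu> z)"
      by (simp add: \<Phi>_def sum_divide_distrib[symmetric] sum.distrib \<mu>_def)
    then show ?thesis using \<nu>_sum[of z] \<mu>_nonneg[OF that] by simp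
  qed
  have \<Phi>_bounds: "\<Phi> z i \<in> {0..1}" if z: "z \<in> S" and i: "i < Suc n" for z i
  proof (cases "i < n")
    case True
    have nn: "0 \<le> \<Phi> z j" if "j < n" for j
      using that \<nu>_nonneg[OF z] F_nonneg[OF z] \<mu>_nonneg[OF z] by (auto simp: \<Phi>_def)
    moreover have "\<Phi> z i \<le> (\<Sum>j<n. \<Phi> z j)"
      by (rule member_le_sum) (use True nn in auto)
    ultimately show ?thesis using \<Phi>_sum[OF z] True by auto
  qed (simp add: \<Phi>_def)
  have c_coord: "continuous_on S (\<lambda>z. z i)" for i
    by (rule continuous_on_subset[OF continuous_on_product_coordinates]) auto
  have c_\<sigma>: "continuous_on S \<sigma>" unfolding \<sigma>_def by (intro continuous_intros c_coord)
  have c_\<nu>: "continuous_on S (\<lambda>z. \<nu> z i)" for i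
    unfolding \<nu>_def using n by (intro continuous_intros c_coord c_\<sigma>) auto
  have c_\<rho>: "continuous_on S \<rho>" unfolding \<rho>_def by (intro continuous_intros c_coord)
  have c_y: "continuous_on S y"
    by (rule continuous_on_coordinatewise_then_product) (unfold y_def, intro continuous_intros c_\<rho> c_\<nu>)
  have c_F: "continuous_on S (\<lambda>z. F (y z) i)" if "i < n" for i
    by (rule continuous_on_compose2[OF cont[OF that] c_y]) (use y_nonneg in auto)
  have c_\<mu>: "continuous_on S \<mu>" unfolding \<mu>_def by (intro continuous_intros c_F) auto
  have c_\<Phi>: "continuous_on S (\<lambda>z. \<Phi> z i)" for i
  proof (cases "i < n")
    case True
    have "1 + \<mu> z \<noteq> 0" if "z \<in> S" for z using \<mu>_nonneg[OF that] by simp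
    then have "continuous_on S (\<lambda>z. (\<nu> z i + F (y z) i) / (1 + \<mu> z))"
      by (intro continuous_intros c_\<nu> c_F[OF True] c_\<mu>) auto
    then show ?thesis using True by (simp add: \<Phi>_def)
  next
    case False
    have "continuous_on S (\<lambda>z. max 0 (min 1 (z n + s * (\<mu> z - \<rho> z))))"
      by (intro continuous_intros c_coord c_\<mu> c_\<rho>)
    then show ?thesis using False by (simp add: \<Phi>_def)
  qed
  obtain z where z: "z \<in> S" and fixz: "\<And>i. i < Suc n \<Longrightarrow> \<Phi> z i = z i"
    using brouwer_nat_cube[of "Suc n" \<Phi>] c_\<Phi> \<Phi>_bounds unfolding S_def[symmetric] by metis
  \<comment> \<open>The first \<open>n\<close> entries of any value of \<open>\<Phi>\<close> add up
    to 1, so a fixed point lies on the simplex, where the retraction is the identity.\<close>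
  have "\<sigma> z = 1" using \<Phi>_sum[OF z] fixz by (simp add: \<sigma>_def)
  then have \<nu>z: "\<nu> z i = z i" for i by (simp add: \<nu>_def)
  have Fz: "F (y z) i = \<mu> z * z i" if "i < n" for i
  proof -
    have "(z i + F (y z) i) / (1 + \<mu> z) = z i"
      using fixz[of i] that by (simp add: \<Phi>_def \<nu>z)
    then show ?thesis using \<mu>_nonneg[OF z] by (simp add: field_simps)
  qed
  have y_sum: "(\<Sum>i<n. y z i) = \<rho> z"
    using \<nu>_sum[of z] by (simp add: y_def sum_distrib_left[symmetric])
  have clip: "max 0 (min 1 (z n + s * (\<mu> z - \<rho> z))) = z n"
    using fixz[of n] by (simp add: \<Phi>_def)
  \<comment> \<open>At the ends the drift points inwards and would move the clipped coordinate. At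
    an inner point the clipped value is unchanged only if the drift is zero.\<close>
  have "z n = 0 \<Longrightarrow> s * (\<mu> z - \<rho> z) > 0"
    using s(1)[OF y_nonneg[OF z]] y_sum by (simp add: \<rho>_def \<mu>_def)
  moreover have "z n = 1 \<Longrightarrow> s * (\<mu> z - \<rho> z) < 0"
    using s(2)[OF y_nonneg[OF z]] y_sum by (simp add: \<rho>_def \<mu>_def)
  ultimately have "s * (\<mu> z - \<rho> z) = 0"
    using clip S_n[OF z] by (auto simp: max_def min_def split: if_splits)
  \<comment> \<open>The strict inequality \<open>s(1)\<close>, tested on the constant vector of size
    \<open>r\<close>, rules out \<open>s = 0\<close>.\<close>
  moreover have "s \<noteq> 0"
  proof
    assume "s = 0"
    then show False using s(1)[of "\<lambda>i. r / n"] r n by simp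
  qed
  ultimately have "\<mu> z = \<rho> z" by (simp only: mult_eq_0_iff right_minus_eq simp_thms)
  show thesis
  proof (rule that[of "y z"])
    show "F (y z) i = y z i" if "i < n" for i
      using Fz[OF that] \<open>\<mu> z = \<rho> z\<close> by (simp add: y_def \<nu>z)
    show "0 \<le> y z i" for i using y_nonneg[OF z] by blast
    show "r \<le> (\<Sum>i<n. y z i)" "(\<Sum>i<n. y z i) \<le> R"
      unfolding y_sum by (fact \<rho>_ge[OF z])+
  qed
qed

section \<open>Midpoint sums and the Dirichlet Green function\<close>

text \<open>Midpoints stay strictly inside the interval, so that dividing by
  \<open>s * (T - s)\<close> at the nodes is harmless.\<close>

definition midpoint_node :: "real \<Rightarrow> nat \<Rightarrow> nat \<Rightarrow> real" where
  "midpoint_node T n i = T * (real i + 1/2) / real n"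

definition midpoint_sum :: "real \<Rightarrow> nat \<Rightarrow> (real \<Rightarrow> real) \<Rightarrow> real" where
  "midpoint_sum T n \<phi> = T / real n * (\<Sum>i<n. \<phi> (midpoint_node T n i))"

lemma midpoint_node_interior:
  assumes "0 < T" "i < n"
  shows "midpoint_node T n i \<in> {0<..<T}"
proof -
  have "real i + 1/2 < real n" using assms(2) by linarith
  then have "T * (real i + 1/2) < T * real n" using assms(1) by simp
  moreover have "0 < T * (real i + 1/2)" using assms(1) by (intro mult_pos_pos) auto
  ultimately show ?thesis
    using assms by (simp add: midpoint_node_def divide_less_eq zero_less_divide_iff)
qed

text \<open>The error is added up cell by cell: uniform continuity bounds it by
  \<open>h * e'\<close> on each cell, hence by \<open>T * e'\<close>, half of the tolerance, in
  total.\<close>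

lemma midpoint_sum_tendsto:
  assumes T: "0 < T" and cont: "continuous_on {0..T} \<phi>"
  shows "(\<lambda>n. midpoint_sum T n \<phi>) \<longlonglongrightarrow> integral {0..T} \<phi>"
proof (rule LIMSEQ_I)
  fix e :: real assume e: "0 < e"
  define e' where "e' = e / (2 * T)"
  have e': "0 < e'" using e T by (simp add: e'_def)
  obtain \<delta> where \<delta>: "0 < \<delta>"
    "\<And>x y. x \<in> {0..T} \<Longrightarrow> y \<in> {0..T} \<Longrightarrow> dist x y < \<delta> \<Longrightarrow> dist (\<phi> x) (\<phi> y) < e'"
    using compact_uniformly_continuous[OF cont] e' unfolding uniformly_continuous_on_def
    by (metis compact_Icc)
  obtain n0 :: nat where n0: "T / \<delta> < real n0" using reals_Archimedean2 by blast
  have "norm (midpoint_sum T n \<phi> - integral {0..T} \<phi>) < e" if n: "n0 \<le> n" for n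
  proof -
    have npos: "0 < n" using n0 n T \<delta>(1) by (metis divide_pos_pos le_0_eq less_asym neq0_conv of_nat_0)
    define h where "h = T / n"
    have h: "0 < h" "h < \<delta>" "h * n = T"
    proof -
      have "T / \<delta> < n" using n0 n by linarith
      then show "h < \<delta>" using \<delta>(1) npos by (simp add: h_def field_simps)
    qed (use T npos in \<open>auto simp: h_def\<close>)
    have "\<bar>h * (\<Sum>i<k. \<phi> (midpoint_node T n i)) - integral {0..h * k} \<phi>\<bar> \<le> h * k * e'"
      if "k \<le> n" for k
      using that
    proof (induction k)
      case (Suc k)
      have le: "h * Suc k \<le> T" using Suc.prems h by (metis mult_left_mono of_nat_le_iff less_imp_le)
      have ik: "0 \<le> h * k" "h * k \<le> h * Suc k" using h by auto
      define s where "s = midpoint_node T n k"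
      have s: "h * k \<le> s" "s \<le> h * Suc k"
        using T npos by (auto simp: s_def h_def midpoint_node_def field_simps)
      have int1: "integral {0..h * Suc k} \<phi> = integral {0..h * k} \<phi> + integral {h * k..h * Suc k} \<phi>"
        by (rule Henstock_Kurzweil_Integration.integral_combine[symmetric])
           (use ik le in \<open>auto intro!: integrable_continuous_real continuous_on_subset[OF cont]\<close>)
      have c: "continuous_on {h * k..h * Suc k} \<phi>"
        using ik le by (intro continuous_on_subset[OF cont]) auto
      have "norm (integral {h * k..h * Suc k} (\<lambda>x. \<phi> x - \<phi> s)) \<le> e' * (h * Suc k - h * k)"
      proof (rule integral_bound)
        show "continuous_on {h * k..h * Suc k} (\<lambda>x. \<phi> x - \<phi> s)" by (intro continuous_intros c)
        show "norm (\<phi> x - \<phi> s) \<le> e'" if x: "x \<in> {h * k..h * Suc k}" for x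
        proof -
          from x have dist_h: "dist x s \<le> h" using s by (auto simp: dist_real_def algebra_simps abs_le_iff)
          have "dist (\<phi> x) (\<phi> s) < e'"
          proof (intro \<delta>(2))
            have "h * k \<le> x" "x \<le> h * Suc k" using x by auto
            then show "x \<in> {0..T}" "s \<in> {0..T}"
              unfolding atLeastAtMost_iff using s ik(1) le by linarith+
          qed (use dist_h h in linarith)
          then show "norm (\<phi> x - \<phi> s) \<le> e'" by (simp add: dist_norm)
        qed
      qed (use ik in simp)
      also have "integral {h * k..h * Suc k} (\<lambda>x. \<phi> x - \<phi> s) = integral {h * k..h * Suc k} \<phi> - h * \<phi> s"
        using ik integral_diff[OF integrable_continuous_real[OF c], of "\<lambda>x. \<phi> s"]
        by (simp add: integrable_continuous_real) (simp add: algebra_simps)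
      finally have "\<bar>integral {h * k..h * Suc k} \<phi> - h * \<phi> s\<bar> \<le> h * e'"
        by (simp add: algebra_simps)
      moreover have "\<bar>h * (\<Sum>i<k. \<phi> (midpoint_node T n i)) - integral {0..h * k} \<phi>\<bar> \<le> h * k * e'"
        using Suc by simp
      moreover have "h * (\<Sum>i<Suc k. \<phi> (midpoint_node T n i)) = h * (\<Sum>i<k. \<phi> (midpoint_node T n i)) + h * \<phi> s"
        by (simp add: s_def algebra_simps)
      moreover have "h * real (Suc k) * e' = h * k * e' + h * e'" by (simp add: algebra_simps)
      ultimately show ?case unfolding int1 by linarith
    qed simp
    from this[of n] have "\<bar>midpoint_sum T n \<phi> - integral {0..T} \<phi>\<bar> \<le> T * e'"
      using h by (simp add: midpoint_sum_def h_def[symmetric])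
    also have "\<dots> < e" using T e by (simp add: e'_def)
    finally show ?thesis by simp
  qed
  then show "\<exists>n0. \<forall>n\<ge>n0. norm (midpoint_sum T n \<phi> - integral {0..T} \<phi>) < e" by blast
qed

lemma midpoint_sum_mono:
  assumes "0 < T" "\<And>s. s \<in> {0<..<T} \<Longrightarrow> \<phi> s \<le> \<psi> s"
  shows "midpoint_sum T n \<phi> \<le> midpoint_sum T n \<psi>"
  unfolding midpoint_sum_def using assms midpoint_node_interior[OF assms(1)]
  by (intro mult_left_mono sum_mono) auto

lemma midpoint_sum_linear:
  "midpoint_sum T n (\<lambda>s. c * \<phi> s + d * \<psi> s) = c * midpoint_sum T n \<phi> + d * midpoint_sum T n \<psi>"
  by (simp add: midpoint_sum_def sum.distrib sum_distrib_left algebra_simps)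

text \<open>Integrand and mesh vary together. Replacing \<open>\<psi> j\<close> by its limit costs
  at most \<open>T\<close> times their uniform distance, whatever the mesh is.\<close>

lemma midpoint_sum_tendsto_uniform:
  assumes T: "0 < T" and cont: "continuous_on {0..T} \<phi>"
    and lim: "uniform_limit {0..T} \<psi> \<phi> sequentially" and N: "filterlim N at_top sequentially"
  shows "(\<lambda>j. midpoint_sum T (N j) (\<psi> j)) \<longlonglongrightarrow> integral {0..T} \<phi>"
proof -
  have "(\<lambda>j. midpoint_sum T (N j) (\<psi> j) - midpoint_sum T (N j) \<phi>) \<longlonglongrightarrow> 0"
  proof (rule tendstoI)
    fix e :: real assume e: "0 < e"
    have "\<forall>\<^sub>F j in sequentially. \<forall>s\<in>{0..T}. dist (\<psi> j s) (\<phi> s) < e / (2 * T)"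
      using lim e T by (auto simp: uniform_limit_iff)
    then show "\<forall>\<^sub>F j in sequentially. dist (midpoint_sum T (N j) (\<psi> j) - midpoint_sum T (N j) \<phi>) 0 < e"
    proof eventually_elim
      case (elim j)
      have "\<bar>\<Sum>i<N j. \<psi> j (midpoint_node T (N j) i) - \<phi> (midpoint_node T (N j) i)\<bar>
          \<le> (\<Sum>i<N j. e / (2 * T))"
      proof (rule order_trans[OF sum_abs sum_mono])
        fix i assume "i \<in> {..<N j}"
        then have "midpoint_node T (N j) i \<in> {0..T}"
          using midpoint_node_interior[OF T, of i "N j"] by auto
        then show "\<bar>\<psi> j (midpoint_node T (N j) i) - \<phi> (midpoint_node T (N j) i)\<bar> \<le> e / (2 * T)"
          using elim by (force simp: dist_real_def)
      qed
      then have "T / N j * \<bar>\<Sum>i<N j. \<psi> j (midpoint_node T (N j) i) - \<phi> (midpoint_node T (N j) i)\<bar>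
          \<le> T / N j * (N j * (e / (2 * T)))"
        using T by (intro mult_left_mono) auto
      also have "\<dots> \<le> e / 2" using T e by (cases "N j = 0") auto
      finally have "\<bar>T / N j * (\<Sum>i<N j. \<psi> j (midpoint_node T (N j) i) - \<phi> (midpoint_node T (N j) i))\<bar> \<le> e / 2"
        using T by (simp add: abs_mult)
      then show ?case
        using e by (simp add: midpoint_sum_def sum_subtractf right_diff_distrib)
    qed
  qed
  moreover have "(\<lambda>j. midpoint_sum T (N j) \<phi>) \<longlonglongrightarrow> integral {0..T} \<phi>"
    by (rule filterlim_compose[OF midpoint_sum_tendsto[OF T cont] N])
  ultimately show ?thesis
    by (rule Lim_transform[rotated])
qed

section \<open>The Dirichlet Green function\<close>

definition dirichlet_green :: "real \<Rightarrow> real \<Rightarrow> real \<Rightarrow> real" where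
  "dirichlet_green T t s = min (t * (T - s)) (s * (T - t)) / T"

text \<open>The minimum selects \<open>s * (T - t)\<close> for \<open>s \<le> t\<close> and
  \<open>t * (T - s)\<close> otherwise. Writing the tail as a difference leaves only integrals from
  0 to \<open>t\<close> and a constant, ready for differentiation in \<open>t\<close>.\<close>

lemma dirichlet_green_integral:
  assumes T: "0 < T" and y: "continuous_on {0..T} y" and t: "t \<in> {0..T}"
  shows "integral {0..T} (\<lambda>s. dirichlet_green T t s * y s) =
    ((T - t) * integral {0..t} (\<lambda>s. s * y s)
      + t * (integral {0..T} (\<lambda>s. (T - s) * y s) - integral {0..t} (\<lambda>s. (T - s) * y s))) / T"
proof -
  have c: "continuous_on {c..d} y" if "0 \<le> c" "d \<le> T" for c d
    using that by (intro continuous_on_subset[OF y]) auto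
  have "integral {0..T} (\<lambda>s. dirichlet_green T t s * y s) =
      integral {0..t} (\<lambda>s. dirichlet_green T t s * y s) + integral {t..T} (\<lambda>s. dirichlet_green T t s * y s)"
    unfolding dirichlet_green_def using t T
    by (intro Henstock_Kurzweil_Integration.integral_combine[symmetric] integrable_continuous_real continuous_intros y) auto
  also have "integral {0..t} (\<lambda>s. dirichlet_green T t s * y s) = integral {0..t} (\<lambda>s. (T - t) / T * (s * y s))"
  proof (rule Henstock_Kurzweil_Integration.integral_cong)
    fix s assume "s \<in> {0..t}"
    then have "s * (T - t) \<le> t * (T - s)" using T by (simp add: algebra_simps)
    then show "dirichlet_green T t s * y s = (T - t) / T * (s * y s)" by (simp add: dirichlet_green_def min_absorb2)
  qed
  also have "integral {t..T} (\<lambda>s. dirichlet_green T t s * y s) = integral {t..T} (\<lambda>s. t / T * ((T - s) * y s))"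
  proof (rule Henstock_Kurzweil_Integration.integral_cong)
    fix s assume "s \<in> {t..T}"
    then have "t * (T - s) \<le> s * (T - t)" using T by (simp add: algebra_simps)
    then show "dirichlet_green T t s * y s = t / T * ((T - s) * y s)" by (simp add: dirichlet_green_def min_absorb1)
  qed
  also have "integral {t..T} (\<lambda>s. t / T * ((T - s) * y s)) = t / T * integral {t..T} (\<lambda>s. (T - s) * y s)"
    by (rule integral_mult_right)
  also have "integral {0..t} (\<lambda>s. (T - t) / T * (s * y s)) = (T - t) / T * integral {0..t} (\<lambda>s. s * y s)"
    by (rule integral_mult_right)
  also have "integral {t..T} (\<lambda>s. (T - s) * y s) = integral {0..T} (\<lambda>s. (T - s) * y s) - integral {0..t} (\<lambda>s. (T - s) * y s)"
    using Henstock_Kurzweil_Integration.integral_combine[of 0 t T "\<lambda>s. (T - s) * y s"] t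
    by (simp add: integrable_continuous_real continuous_intros c)
  finally show ?thesis by (simp add: add_divide_distrib)
qed

text \<open>In the first derivative the terms \<open>t * (T - t) * y t\<close> from the two variable
  limits cancel, so it contains only integrals and can be differentiated again. In the application
  \<open>p\<close> and \<open>q\<close> are the boundary values of \<open>u\<close> itself.\<close>

lemma C2_on_dirichlet_green:
  assumes T: "0 < T" and y: "continuous_on {0..T} y"
    and u: "\<And>t. t \<in> {0..T} \<Longrightarrow>
      u t = integral {0..T} (\<lambda>s. dirichlet_green T t s * y s) + p * (1 - t / T) + q * (t / T)"
  shows "\<exists>u'. C2_on T u u' (\<lambda>t. - y t)"
proof -
  define Y1 where "Y1 t = integral {0..t} (\<lambda>s. s * y s)" for t
  define Y2 where "Y2 t = integral {0..t} (\<lambda>s. (T - s) * y s)" for t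
  define u' where "u' t = (Y2 T - Y1 t - Y2 t + q - p) / T" for t
  have Y1: "(Y1 has_real_derivative t * y t) (at t within {0..T})" if "t \<in> {0..T}" for t
    unfolding Y1_def[abs_def] by (intro integral_has_real_derivative continuous_intros y that)
  have Y2: "(Y2 has_real_derivative (T - t) * y t) (at t within {0..T})" if "t \<in> {0..T}" for t
    unfolding Y2_def[abs_def] by (intro integral_has_real_derivative continuous_intros y that)
  have u_eq: "u t = ((T - t) * Y1 t + t * (Y2 T - Y2 t)) / T + p * (1 - t / T) + q * (t / T)"
    if "t \<in> {0..T}" for t
    using u[OF that] dirichlet_green_integral[OF T y that] by (simp add: Y1_def Y2_def)
  have "(u has_real_derivative u' t) (at t within {0..T})" if t: "t \<in> {0..T}" for t
  proof (rule has_field_derivative_transform_within[where d = 1])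
    show "((\<lambda>t. ((T - t) * Y1 t + t * (Y2 T - Y2 t)) / T + p * (1 - t / T) + q * (t / T))
        has_real_derivative u' t) (at t within {0..T})"
      using T by (auto intro!: derivative_eq_intros Y1[OF t] Y2[OF t] simp: u'_def field_simps)
  qed (use t u_eq in auto)
  moreover have "(u' has_real_derivative - y t) (at t within {0..T})" if t: "t \<in> {0..T}" for t
    unfolding u'_def[abs_def]
    using T by (auto intro!: derivative_eq_intros Y1[OF t] Y2[OF t] simp: field_simps)
  ultimately show ?thesis
    using y unfolding C2_on_def by (intro exI[of _ u']) (auto intro!: continuous_intros)
qed

text \<open>As a function of \<open>t\<close> the kernel is largest on the diagonal, which gives the
  upper bound. For the lower one, the branches \<open>t * (T - s)\<close> and
  \<open>s * (T - t)\<close> are multiplied by the missing factors \<open>s / T\<close> and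
  \<open>(T - s) / T\<close>, both at most 1.\<close>

lemma dirichlet_green_bounds:
  assumes T: "0 < T" and t: "t \<in> {0..T}" and s: "s \<in> {0..T}"
  shows "min t (T - t) / T\<^sup>2 * (s * (T - s)) \<le> dirichlet_green T t s"
    and "dirichlet_green T t s \<le> s * (T - s) / T"
    and "0 \<le> dirichlet_green T t s"
proof -
  have st: "0 \<le> s" "0 \<le> T - s" "0 \<le> t" "0 \<le> T - t" using s t by auto
  have "min t (T - t) * (s * (T - s)) \<le> T * min (t * (T - s)) (s * (T - t))"
  proof -
    have "min t (T - t) * (s * (T - s)) \<le> t * (s * (T - s))"
      using st by (intro mult_right_mono mult_nonneg_nonneg) auto
    also have "\<dots> \<le> t * (T * (T - s))"
      using st by (intro mult_left_mono mult_right_mono) auto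
    finally have 1: "min t (T - t) * (s * (T - s)) \<le> T * (t * (T - s))" by (simp add: algebra_simps)
    have "min t (T - t) * (s * (T - s)) \<le> (T - t) * (s * (T - s))"
      using st by (intro mult_right_mono mult_nonneg_nonneg) auto
    also have "\<dots> \<le> (T - t) * (s * T)"
      using st by (intro mult_left_mono) auto
    finally have "min t (T - t) * (s * (T - s)) \<le> T * (s * (T - t))" by (simp add: algebra_simps)
    with 1 show ?thesis by (simp add: min_def)
  qed
  then show "min t (T - t) / T\<^sup>2 * (s * (T - s)) \<le> dirichlet_green T t s"
    using T by (simp add: dirichlet_green_def power2_eq_square divide_le_eq mult.commute)
  have "min (t * (T - s)) (s * (T - t)) \<le> s * (T - s)"
  proof (cases "t \<le> s")
    case True
    then have "t * (T - s) \<le> s * (T - s)" using st by (intro mult_right_mono) auto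
    then show ?thesis by simp
  next
    case False
    then have "s * (T - t) \<le> s * (T - s)" using st by (intro mult_left_mono) auto
    then show ?thesis by simp
  qed
  then show "dirichlet_green T t s \<le> s * (T - s) / T"
    unfolding dirichlet_green_def using T by (intro divide_right_mono) auto
  show "0 \<le> dirichlet_green T t s"
    unfolding dirichlet_green_def using T st by simp
qed

text \<open>Before division by \<open>T\<close>, the two branches are affine in \<open>t\<close>
  with slopes \<open>T - s\<close> and \<open>- s\<close>, of modulus at most \<open>T\<close>; a
  minimum inherits the Lipschitz constant.\<close>

lemma dirichlet_green_lipschitz:
  assumes T: "0 < T" and s: "s \<in> {0..T}"
  shows "\<bar>dirichlet_green T t s - dirichlet_green T t' s\<bar> \<le> \<bar>t - t'\<bar>"
proof -
  have min_diff: "\<bar>min x z - min x' z'\<bar> \<le> max \<bar>x - x'\<bar> \<bar>z - z'\<bar>" for x z x' z' :: real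
    by (auto simp: min_def max_def)
  have "\<bar>t * (T - s) - t' * (T - s)\<bar> = (T - s) * \<bar>t - t'\<bar>"
    using s by (simp add: left_diff_distrib[symmetric] abs_mult mult.commute)
  moreover have "\<bar>s * (T - t) - s * (T - t')\<bar> = s * \<bar>t - t'\<bar>"
    using s by (simp add: right_diff_distrib[symmetric] abs_mult abs_minus_commute)
  moreover have "(T - s) * \<bar>t - t'\<bar> \<le> T * \<bar>t - t'\<bar>" "s * \<bar>t - t'\<bar> \<le> T * \<bar>t - t'\<bar>"
    using s by (intro mult_right_mono; simp)+
  ultimately have "\<bar>min (t * (T - s)) (s * (T - t)) - min (t' * (T - s)) (s * (T - t'))\<bar> \<le> T * \<bar>t - t'\<bar>"
    using min_diff[of "t * (T - s)" "s * (T - t)" "t' * (T - s)" "s * (T - t')"] by linarith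
  then show ?thesis
    unfolding dirichlet_green_def diff_divide_distrib[symmetric]
    using T by (simp add: abs_divide divide_le_eq mult.commute)
qed

section \<open>The Green function of the boundary value problem\<close>

locale integral_bvp =
  fixes T \<eta> \<alpha> \<beta> :: real
  assumes T_pos: "0 < T" and \<eta>_pos: "0 < \<eta>" and \<eta>_less: "\<eta> < T"
    and \<alpha>_pos: "0 < \<alpha>" and \<alpha>_less: "\<alpha> < 2 * T / \<eta>\<^sup>2"
    and \<beta>_nonneg: "0 \<le> \<beta>"
    and \<beta>_less: "\<beta> < (2 * T - \<alpha> * \<eta>\<^sup>2) / (\<alpha> * \<eta>\<^sup>2 - 2 * \<eta> + 2 * T)"
begin

text \<open>The boundary conditions on the affine part \<open>p (1 - t/T) + q t/T\<close> form the linear system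
  \<open>c\<^sub>1 p - c\<^sub>2 q = \<beta> g(\<eta>)\<close>, \<open>c\<^sub>4 q - c\<^sub>3 p = \<alpha> \<integral>g\<close>, with \<open>g\<close> the Dirichlet part.\<close>

definition c1 :: real where "c1 = 1 - \<beta> * (1 - \<eta> / T)"
definition c2 :: real where "c2 = \<beta> * (\<eta> / T)"
definition c3 :: real where "c3 = \<alpha> * (\<eta> - \<eta>\<^sup>2 / (2 * T))"
definition c4 :: real where "c4 = 1 - \<alpha> * (\<eta>\<^sup>2 / (2 * T))"

definition green_avg :: "real \<Rightarrow> real" where
  "green_avg s = integral {0..\<eta>} (\<lambda>t. dirichlet_green T t s)"

text \<open>Cramer's rule for the system above, with a unit source at \<open>s\<close>:
  \<open>green_left s\<close> is the unknown p and \<open>green_right s\<close> the unknown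
  q.\<close>

definition green_left :: "real \<Rightarrow> real" where
  "green_left s = (c4 * \<beta> * dirichlet_green T \<eta> s + c2 * \<alpha> * green_avg s) / (c1 * c4 - c2 * c3)"

definition green_right :: "real \<Rightarrow> real" where
  "green_right s = (c1 * \<alpha> * green_avg s + c3 * \<beta> * dirichlet_green T \<eta> s) / (c1 * c4 - c2 * c3)"

definition green :: "real \<Rightarrow> real \<Rightarrow> real" where
  "green t s = dirichlet_green T t s + green_left s * (1 - t / T) + green_right s * (t / T)"

text \<open>The bound on \<alpha> amounts to \<open>0 < c4\<close>, the bound on \<beta> to a
  positive determinant. So the inverse matrix has non-negative entries, and the affine part of
  \<open>green\<close> is non-negative on the interval.\<close>

lemma coeffs: "0 \<le> c2" "0 \<le> c3" "0 < c4" "0 < c1 * c4 - c2 * c3" "0 < c1"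
proof -
  show c2: "0 \<le> c2" using \<beta>_nonneg \<eta>_pos T_pos by (simp add: c2_def)
  have "\<eta>\<^sup>2 \<le> \<eta> * (2 * T)" using \<eta>_pos \<eta>_less by (simp add: power2_eq_square)
  then have "\<eta>\<^sup>2 / (2 * T) \<le> \<eta>" using T_pos by (simp add: divide_le_eq)
  then show c3: "0 \<le> c3" using \<alpha>_pos by (simp add: c3_def)
  have "\<alpha> * \<eta>\<^sup>2 < 2 * T" using \<alpha>_less \<eta>_pos by (simp add: less_divide_eq)
  then show c4: "0 < c4" using T_pos by (simp add: c4_def divide_less_eq)
  have "0 < \<alpha> * \<eta>\<^sup>2 - 2 * \<eta> + 2 * T"
    using mult_pos_pos[OF \<alpha>_pos zero_less_power[OF \<eta>_pos, of 2]] \<eta>_less by linarith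
  then have "0 < 2 * T - \<alpha> * \<eta>\<^sup>2 - \<beta> * (\<alpha> * \<eta>\<^sup>2 - 2 * \<eta> + 2 * T)"
    using \<beta>_less by (simp add: less_divide_eq)
  also have "\<dots> = 2 * T * (c1 * c4 - c2 * c3)"
    using T_pos by (simp add: c1_def c2_def c3_def c4_def field_simps power2_eq_square)
  finally show D: "0 < c1 * c4 - c2 * c3" using T_pos by (simp add: zero_less_mult_iff)
  then have "0 < c1 * c4" using mult_nonneg_nonneg[OF c2 c3] by linarith
  then show "0 < c1" using c4 by (simp add: zero_less_mult_iff)
qed

lemma continuous_on_dirichlet_green_left: "continuous_on S (\<lambda>t. dirichlet_green T t s)"
  unfolding dirichlet_green_def using T_pos by (intro continuous_intros) auto

lemma continuous_on_green: "continuous_on S (\<lambda>t. green t s)"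
  unfolding green_def using T_pos
  by (intro continuous_intros continuous_on_dirichlet_green_left) auto

lemma green_0: "s \<in> {0..T} \<Longrightarrow> green 0 s = green_left s"
  and green_T: "s \<in> {0..T} \<Longrightarrow> green T s = green_right s"
  using T_pos by (auto simp: green_def dirichlet_green_def)

lemma green_boundary_left:
  assumes "s \<in> {0..T}"
  shows "green 0 s = \<beta> * green \<eta> s"
proof -
  have "c1 * green_left s - c2 * green_right s = \<beta> * dirichlet_green T \<eta> s"
  proof -
    have "c1 * green_left s - c2 * green_right s
        = \<beta> * dirichlet_green T \<eta> s * (c1 * c4 - c2 * c3) / (c1 * c4 - c2 * c3)"
      unfolding green_left_def green_right_def times_divide_eq_right diff_divide_distrib[symmetric]
      by (intro arg_cong2[where f = "(/)"]) (auto simp: algebra_simps)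
    then show ?thesis using coeffs(4) by simp
  qed
  then have "green_left s = \<beta> * green \<eta> s"
    unfolding green_def c1_def c2_def by (simp add: algebra_simps)
  then show ?thesis using green_0[OF assms] by simp
qed

lemma green_boundary_right:
  assumes "s \<in> {0..T}"
  shows "green T s = \<alpha> * integral {0..\<eta>} (\<lambda>t. green t s)"
proof -
  have lin: "((\<lambda>t. green_left s * (1 - t / T) + green_right s * (t / T)) has_integral
      (green_left s * (\<eta> - \<eta>\<^sup>2 / (2 * T)) + green_right s * (\<eta>\<^sup>2 / (2 * T)))
      - (green_left s * (0 - 0\<^sup>2 / (2 * T)) + green_right s * (0\<^sup>2 / (2 * T)))) {0..\<eta>}"
    by (rule fundamental_theorem_of_calculus)
       (use \<eta>_pos T_pos in \<open>auto intro!: derivative_eq_intros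
         simp: has_real_derivative_iff_has_vector_derivative[symmetric] field_simps\<close>)
  have "((\<lambda>t. dirichlet_green T t s) has_integral green_avg s) {0..\<eta>}"
    unfolding green_avg_def
    by (intro integrable_integral integrable_continuous_real continuous_on_dirichlet_green_left)
  from has_integral_add[OF this lin] have int: "integral {0..\<eta>} (\<lambda>t. green t s) =
      green_avg s + (green_left s * (\<eta> - \<eta>\<^sup>2 / (2 * T)) + green_right s * (\<eta>\<^sup>2 / (2 * T)))"
    by (simp add: green_def add.assoc integral_unique)
  have "c4 * green_right s - c3 * green_left s = \<alpha> * green_avg s"
  proof -
    have "c4 * green_right s - c3 * green_left s
        = \<alpha> * green_avg s * (c1 * c4 - c2 * c3) / (c1 * c4 - c2 * c3)"
      unfolding green_left_def green_right_def times_divide_eq_right diff_divide_distrib[symmetric]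
      by (intro arg_cong2[where f = "(/)"]) (auto simp: algebra_simps)
    then show ?thesis using coeffs(4) by simp
  qed
  then have "green_right s = \<alpha> * integral {0..\<eta>} (\<lambda>t. green t s)"
    unfolding int c3_def c4_def by (simp add: algebra_simps)
  then show ?thesis using green_T[OF assms] by simp
qed

lemma green_avg_bounds:
  assumes "s \<in> {0..T}"
  shows "0 \<le> green_avg s" "green_avg s \<le> \<eta> * (s * (T - s) / T)"
proof -
  have int: "(\<lambda>t. dirichlet_green T t s) integrable_on {0..\<eta>}"
    by (intro integrable_continuous_real continuous_on_dirichlet_green_left)
  show "0 \<le> green_avg s"
    unfolding green_avg_def using \<eta>_less assms
    by (intro integral_nonneg int dirichlet_green_bounds T_pos) auto
  have "green_avg s \<le> integral {0..\<eta>} (\<lambda>t. s * (T - s) / T)"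
    unfolding green_avg_def using \<eta>_less assms
    by (intro integral_le int dirichlet_green_bounds T_pos integrable_const_ivl) auto
  then show "green_avg s \<le> \<eta> * (s * (T - s) / T)" using \<eta>_pos by (simp add: mult_ac)
qed

text \<open>Both numerators are non-negative combinations of the Dirichlet kernel at \<eta> and its
  integral over \<open>{0..\<eta>}\<close>, which carry the factor
  \<open>s * (T - s)\<close>.\<close>

lemma green_affine_bound:
  obtains C where "0 \<le> C"
    "\<And>s. s \<in> {0..T} \<Longrightarrow> green_left s \<in> {0..C * (s * (T - s))}"
    "\<And>s. s \<in> {0..T} \<Longrightarrow> green_right s \<in> {0..C * (s * (T - s))}"
proof -
  define D where "D = c1 * c4 - c2 * c3"
  define C1 where "C1 = (c4 * \<beta> * (1 / T) + c2 * \<alpha> * (\<eta> / T)) / D"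
  define C2 where "C2 = (c1 * \<alpha> * (\<eta> / T) + c3 * \<beta> * (1 / T)) / D"
  have D: "0 < D" using coeffs by (simp add: D_def)
  have C12: "0 \<le> C1" "0 \<le> C2"
    unfolding C1_def C2_def using coeffs \<beta>_nonneg \<alpha>_pos \<eta>_pos T_pos D by auto
  have L: "green_left s \<in> {0..C1 * (s * (T - s))}" and R: "green_right s \<in> {0..C2 * (s * (T - s))}"
    if s: "s \<in> {0..T}" for s
  proof -
    have \<eta>: "\<eta> \<in> {0..T}" using \<eta>_pos \<eta>_less by auto
    note A = dirichlet_green_bounds[OF T_pos \<eta> s] and I = green_avg_bounds[OF s]
    have "c4 * \<beta> * dirichlet_green T \<eta> s + c2 * \<alpha> * green_avg s
        \<le> c4 * \<beta> * (s * (T - s) / T) + c2 * \<alpha> * (\<eta> * (s * (T - s) / T))"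
      using A I coeffs \<beta>_nonneg \<alpha>_pos by (intro add_mono mult_left_mono) auto
    also have "\<dots> = (c4 * \<beta> * (1 / T) + c2 * \<alpha> * (\<eta> / T)) * (s * (T - s))"
      by (simp add: algebra_simps)
    finally have "green_left s \<le> C1 * (s * (T - s))"
      unfolding green_left_def C1_def D_def[symmetric] times_divide_eq_left
      by (rule divide_right_mono) (use D in simp)
    moreover have "0 \<le> green_left s"
      unfolding green_left_def D_def[symmetric] using A I coeffs \<beta>_nonneg \<alpha>_pos D by auto
    ultimately show "green_left s \<in> {0..C1 * (s * (T - s))}" by simp
    have "c1 * \<alpha> * green_avg s + c3 * \<beta> * dirichlet_green T \<eta> s
        \<le> c1 * \<alpha> * (\<eta> * (s * (T - s) / T)) + c3 * \<beta> * (s * (T - s) / T)"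
      using A I coeffs \<beta>_nonneg \<alpha>_pos by (intro add_mono mult_left_mono) auto
    also have "\<dots> = (c1 * \<alpha> * (\<eta> / T) + c3 * \<beta> * (1 / T)) * (s * (T - s))"
      by (simp add: algebra_simps)
    finally have "green_right s \<le> C2 * (s * (T - s))"
      unfolding green_right_def C2_def D_def[symmetric] times_divide_eq_left
      by (rule divide_right_mono) (use D in simp)
    moreover have "0 \<le> green_right s"
      unfolding green_right_def D_def[symmetric] using A I coeffs \<beta>_nonneg \<alpha>_pos D by auto
    ultimately show "green_right s \<in> {0..C2 * (s * (T - s))}" by simp
  qed
  have le: "C1 * (s * (T - s)) \<le> (C1 + C2) * (s * (T - s))" "C2 * (s * (T - s)) \<le> (C1 + C2) * (s * (T - s))"
    if "s \<in> {0..T}" for s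
    using that C12 by (intro mult_right_mono mult_nonneg_nonneg; simp)+
  show thesis
  proof (rule that[of "C1 + C2"])
    show "green_left s \<in> {0..(C1 + C2) * (s * (T - s))}" if "s \<in> {0..T}" for s
      using L[OF that] le(1)[OF that] unfolding atLeastAtMost_iff by linarith
    show "green_right s \<in> {0..(C1 + C2) * (s * (T - s))}" if "s \<in> {0..T}" for s
      using R[OF that] le(2)[OF that] unfolding atLeastAtMost_iff by linarith
  qed (use C12 in simp)
qed

text \<open>The factor \<open>s (T - s)\<close> in both bounds is what makes the estimates insensitive to mass
  concentrating at the end points.\<close>

lemma green_estimates:
  obtains C L where "0 < C" "0 \<le> L"
    "\<And>t s. t \<in> {0..T} \<Longrightarrow> s \<in> {0..T} \<Longrightarrow>
      green t s \<in> {min t (T - t) / T\<^sup>2 * (s * (T - s)) .. C * (s * (T - s))}"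
    "\<And>t t' s. s \<in> {0..T} \<Longrightarrow> \<bar>green t s - green t' s\<bar> \<le> L * \<bar>t - t'\<bar>"
proof -
  obtain C where C: "0 \<le> C"
    "\<And>s. s \<in> {0..T} \<Longrightarrow> green_left s \<in> {0..C * (s * (T - s))}"
    "\<And>s. s \<in> {0..T} \<Longrightarrow> green_right s \<in> {0..C * (s * (T - s))}"
    by (rule green_affine_bound) blast
  have est: "green t s \<in> {min t (T - t) / T\<^sup>2 * (s * (T - s)) .. (1 / T + C) * (s * (T - s))}"
    if t: "t \<in> {0..T}" and s: "s \<in> {0..T}" for t s
  proof -
    note D = dirichlet_green_bounds[OF T_pos t s]
    have w: "0 \<le> 1 - t / T" "0 \<le> t / T" using t T_pos by auto
    define A where "A = green_left s * (1 - t / T) + green_right s * (t / T)"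
    have "0 \<le> A"
      unfolding A_def using w C(2,3)[OF s] by (intro add_nonneg_nonneg mult_nonneg_nonneg) auto
    have "A \<le> C * (s * (T - s)) * (1 - t / T) + C * (s * (T - s)) * (t / T)"
      unfolding A_def using w C(2,3)[OF s] by (intro add_mono mult_right_mono) auto
    also have "\<dots> = C * (s * (T - s)) * (1 - t / T + t / T)" by (rule distrib_left[symmetric])
    finally have "A \<le> C * (s * (T - s))" by simp
    have "green t s = dirichlet_green T t s + A" by (simp add: green_def A_def)
    moreover have "dirichlet_green T t s + A \<le> s * (T - s) / T + C * (s * (T - s))"
      by (rule add_mono[OF D(2) \<open>A \<le> C * (s * (T - s))\<close>])
    moreover have "s * (T - s) / T + C * (s * (T - s)) = (1 / T + C) * (s * (T - s))"
      by (simp add: distrib_right)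
    ultimately show ?thesis
      using D(1) \<open>0 \<le> A\<close> by simp
  qed
  \<comment> \<open>The Dirichlet part contributes slope 1; the affine part has slope
    \<open>(green_right s - green_left s) / T\<close>, where both values are at most
    \<open>C * T\<^sup>2\<close> because \<open>s * (T - s) \<le> T\<^sup>2\<close>.\<close>
  define L where "L = 1 + 2 * (C * T\<^sup>2) / T"
  have lip: "\<bar>green t s - green t' s\<bar> \<le> L * \<bar>t - t'\<bar>" if s: "s \<in> {0..T}" for t t' s
  proof -
    have "s * (T - s) \<le> T * T" using s by (intro mult_mono) auto
    then have "C * (s * (T - s)) \<le> C * T\<^sup>2"
      using C(1) by (intro mult_left_mono) (auto simp: power2_eq_square)
    then have "\<bar>green_right s - green_left s\<bar> \<le> 2 * (C * T\<^sup>2)"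
      using C(2,3)[OF s] by auto
    then have "\<bar>green_right s - green_left s\<bar> / T * \<bar>t - t'\<bar> \<le> 2 * (C * T\<^sup>2) / T * \<bar>t - t'\<bar>"
      using T_pos by (intro mult_right_mono divide_right_mono) auto
    then have le: "\<bar>(green_right s - green_left s) / T * (t - t')\<bar> \<le> 2 * (C * T\<^sup>2) / T * \<bar>t - t'\<bar>"
      using T_pos by (simp add: abs_mult)
    have "green t s - green t' s = (dirichlet_green T t s - dirichlet_green T t' s)
        + (green_right s - green_left s) / T * (t - t')"
      using T_pos by (simp add: green_def field_simps)
    also have "\<bar>\<dots>\<bar> \<le> \<bar>t - t'\<bar> + 2 * (C * T\<^sup>2) / T * \<bar>t - t'\<bar>"
      by (rule order_trans[OF abs_triangle_ineq add_mono[OF dirichlet_green_lipschitz[OF T_pos s] le]])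
    finally have "\<bar>green t s - green t' s\<bar> \<le> \<bar>t - t'\<bar> + 2 * (C * T\<^sup>2) / T * \<bar>t - t'\<bar>" .
    then show ?thesis by (simp add: L_def distrib_right)
  qed
  show thesis
  proof (rule that[of "1 / T + C" L])
    show "0 < 1 / T + C" "0 \<le> L"
      using C(1) T_pos by (auto simp: L_def intro!: add_pos_nonneg)
  qed (fact est lip)+
qed

end

section \<open>Discretised problem\<close>

lemma continuous_on_Icc_abs_bound:
  fixes f :: "real \<Rightarrow> real"
  assumes "continuous_on {p..q} f"
  obtains K where "0 \<le> K" "\<And>x. x \<in> {p..q} \<Longrightarrow> \<bar>f x\<bar> \<le> K"
proof -
  have "bounded (f ` {p..q})"
    by (intro compact_imp_bounded compact_continuous_image assms compact_Icc)
  then show thesis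
    using that unfolding bounded_pos by (metis imageI less_imp_le real_norm_def)
qed

lemma sublinear_at_0_bound:
  fixes f :: "real \<Rightarrow> real"
  assumes "((\<lambda>x. f x / x) \<longlongrightarrow> 0) (at_right 0)" "0 < e"
  obtains \<delta> where "0 < \<delta>" "\<And>x. x \<in> {0<..\<delta>} \<Longrightarrow> f x \<le> e * x"
proof -
  have "\<forall>\<^sub>F x in at_right 0. f x / x < e" by (rule order_tendstoD(2)[OF assms])
  then obtain b where b: "0 < b" "\<And>x. 0 < x \<Longrightarrow> x < b \<Longrightarrow> f x / x < e"
    unfolding eventually_at_right_field by blast
  have "f x \<le> e * x" if "x \<in> {0<..b/2}" for x
    using b(2)[of x] that b(1) by (simp add: divide_less_eq)
  then show thesis using that[of "b/2"] b(1) by simp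
qed

lemma superlinear_at_0_bound:
  fixes f :: "real \<Rightarrow> real"
  assumes "filterlim (\<lambda>x. f x / x) at_top (at_right 0)"
  obtains \<delta> where "0 < \<delta>" "\<And>x. x \<in> {0<..\<delta>} \<Longrightarrow> M * x \<le> f x"
proof -
  have "\<forall>\<^sub>F x in at_right 0. M \<le> f x / x" using assms by (simp add: filterlim_at_top)
  then obtain b where b: "0 < b" "\<And>x. 0 < x \<Longrightarrow> x < b \<Longrightarrow> M \<le> f x / x"
    unfolding eventually_at_right_field by blast
  have "M * x \<le> f x" if "x \<in> {0<..b/2}" for x
    using b(2)[of x] that b(1) by (simp add: le_divide_eq)
  then show thesis using that[of "b/2"] b(1) by simp
qed

text \<open>The shift by \<open>U\<close> makes the left side non-positive where the growth says
  nothing, so the bound is global. It has to be, since the approximate solutions need not be large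
  near 0 and \<open>T\<close>.\<close>

lemma superlinear_at_top_bound:
  fixes f :: "real \<Rightarrow> real"
  assumes "filterlim (\<lambda>x. f x / x) at_top at_top" "0 \<le> M" "\<And>x. 0 \<le> x \<Longrightarrow> 0 \<le> f x"
  obtains U where "0 \<le> U" "\<And>x. 0 \<le> x \<Longrightarrow> M * (x - U) \<le> f x"
proof -
  have "\<forall>\<^sub>F x in at_top. M \<le> f x / x" using assms(1) by (simp add: filterlim_at_top)
  then obtain N where N: "\<And>x. N \<le> x \<Longrightarrow> M \<le> f x / x"
    unfolding eventually_at_top_linorder by blast
  define U where "U = max 1 N"
  have "M * (x - U) \<le> f x" if x: "0 \<le> x" for x
  proof (cases "x \<le> U")
    case True
    then have "M * (x - U) \<le> 0" using assms(2) by (simp add: mult_nonneg_nonpos)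
    then show ?thesis using assms(3)[OF x] by linarith
  next
    case False
    then have "M * x \<le> f x" using N[of x] by (auto simp: U_def le_divide_eq)
    moreover have "0 \<le> M * U" using assms(2) by (simp add: U_def)
    ultimately show ?thesis by (simp add: right_diff_distrib)
  qed
  then show thesis using that[of U] by (simp add: U_def)
qed

text \<open>\<open>K\<close> bounds \<open>f\<close> on the compact range before the quotient falls
  below \<open>e\<close>; it is later absorbed by a large size.\<close>

lemma sublinear_at_top_bound:
  fixes f :: "real \<Rightarrow> real"
  assumes "((\<lambda>x. f x / x) \<longlongrightarrow> 0) at_top" "0 < e" "continuous_on {0..} f"
  obtains K where "0 \<le> K" "\<And>x. 0 \<le> x \<Longrightarrow> f x \<le> e * x + K"
proof -
  have "\<forall>\<^sub>F x in at_top. f x / x < e" by (rule order_tendstoD(2)[OF assms(1,2)])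
  then obtain N where N: "\<And>x. N \<le> x \<Longrightarrow> f x / x < e"
    unfolding eventually_at_top_linorder by blast
  define U where "U = max 1 N"
  obtain K where K: "0 \<le> K" "\<And>x. x \<in> {0..U} \<Longrightarrow> \<bar>f x\<bar> \<le> K"
    using continuous_on_Icc_abs_bound[OF continuous_on_subset[OF assms(3), of "{0..U}"]] by auto
  have "f x \<le> e * x + K" if x: "0 \<le> x" for x
  proof (cases "x \<le> U")
    case True
    then have "f x \<le> K" using K(2)[of x] x by auto
    moreover have "0 \<le> e * x" using assms(2) x by simp
    ultimately show ?thesis by linarith
  next
    case False
    then have "f x < e * x" using N[of x] by (auto simp: U_def divide_less_eq)
    then show ?thesis using K(1) by linarith
  qed
  then show thesis using that[of K] K(1) by blast
qed

section \<open>The discretised operator and its size estimates\<close>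

locale nonlinear_bvp = integral_bvp +
  fixes a f :: "real \<Rightarrow> real" and C L :: real
  assumes cont_f: "continuous_on {0..} f" and f_nonneg: "\<And>x. 0 \<le> x \<Longrightarrow> 0 \<le> f x"
    and cont_a: "continuous_on {0..T} a" and a_nonneg: "\<And>t. t \<in> {0..T} \<Longrightarrow> 0 \<le> a t"
    and a_pos: "\<exists>t\<in>{0..T}. 0 < a t"
    and C_pos: "0 < C" and L_nonneg: "0 \<le> L"
    and green_bounds: "\<And>t s. t \<in> {0..T} \<Longrightarrow> s \<in> {0..T} \<Longrightarrow>
      green t s \<in> {min t (T - t) / T\<^sup>2 * (s * (T - s)) .. C * (s * (T - s))}"
    and green_lipschitz: "\<And>t t' s. s \<in> {0..T} \<Longrightarrow> \<bar>green t s - green t' s\<bar> \<le> L * \<bar>t - t'\<bar>"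
begin

definition profile :: "real \<Rightarrow> real" where "profile t = min t (T - t) / T\<^sup>2"
definition weight :: "real \<Rightarrow> real" where "weight s = a s * (s * (T - s))"
definition mass :: real where "mass = integral {0..T} weight"
text \<open>Up to quadrature error, the operator with \<open>f u = u\<close> multiplies the size by
  at least this number.\<close>

definition kappa :: real where "kappa = integral {0..T} (\<lambda>s. weight s * profile s)"

text \<open>\<open>d j\<close> stands for the mesh width times \<open>s * (T - s) * y s\<close> at
  the node, not for a value of the solution. Thus the sum of \<open>d\<close> is the discrete size,
  and the quotients of kernel and factor lie between \<open>profile t\<close> and
  \<open>C\<close>.\<close>

definition approx :: "nat \<Rightarrow> (nat \<Rightarrow> real) \<Rightarrow> real \<Rightarrow> real" where
  "approx n d t = (\<Sum>j<n. d j * (green t (midpoint_node T n j)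
     / (midpoint_node T n j * (T - midpoint_node T n j))))"

definition step :: "nat \<Rightarrow> (nat \<Rightarrow> real) \<Rightarrow> nat \<Rightarrow> real" where
  "step n d i = T / real n *
     (weight (midpoint_node T n i) * f (approx n d (midpoint_node T n i)))"

lemma sum_step: "(\<Sum>i<n. step n d i) = midpoint_sum T n (\<lambda>s. weight s * f (approx n d s))"
  by (simp add: step_def midpoint_sum_def sum_distrib_left)

lemma profile_pos: "t \<in> {0<..<T} \<Longrightarrow> 0 < profile t"
  by (simp add: profile_def)

lemma profile_nonneg: "t \<in> {0..T} \<Longrightarrow> 0 \<le> profile t"
  by (simp add: profile_def)

lemma weight_nonneg: "s \<in> {0..T} \<Longrightarrow> 0 \<le> weight s"
  using a_nonneg by (simp add: weight_def)

lemma continuous_on_weight: "continuous_on {0..T} weight"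
  unfolding weight_def by (intro continuous_intros cont_a)

lemma continuous_on_profile: "continuous_on S profile"
  unfolding profile_def using T_pos by (intro continuous_intros) auto

lemma mass_nonneg: "0 \<le> mass"
  unfolding mass_def
  by (intro integral_nonneg integrable_continuous_real continuous_on_weight weight_nonneg)

lemma kappa_pos: "0 < kappa"
proof -
  have cont: "continuous_on {0..T} (\<lambda>s. weight s * profile s)"
    by (intro continuous_intros continuous_on_weight continuous_on_profile)
  have nonneg: "0 \<le> weight s * profile s" if "s \<in> {0..T}" for s
    using that by (intro mult_nonneg_nonneg weight_nonneg profile_nonneg)
  have "kappa \<noteq> 0"
  proof
    assume "kappa = 0"
    then have "\<forall>s\<in>{0..T}. weight s * profile s = 0"
      using integral_eq_0_iff[OF cont T_pos nonneg] by (simp add: kappa_def)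
    then have "a s = 0" if "s \<in> {0<..<T}" for s
      using that profile_pos[OF that] by (force simp: weight_def)
    \<comment> \<open>The point where \<open>a\<close> is positive may be an end point, where the
      weight vanishes anyway; continuity carries the zero from the interior to the closure.\<close>
    then have "a s = 0" if "s \<in> {0..T}" for s
      using continuous_constant_on_closure[of "{0<..<T}" a 0 s] cont_a T_pos that by simp
    then show False using a_pos by force
  qed
  moreover have "0 \<le> kappa"
    unfolding kappa_def by (intro integral_nonneg integrable_continuous_real cont nonneg)
  ultimately show ?thesis by simp
qed

lemma approx_bounds:
  assumes d: "\<forall>i. 0 \<le> d i" and t: "t \<in> {0..T}"
  shows "approx n d t \<in> {profile t * (\<Sum>j<n. d j)..C * (\<Sum>j<n. d j)}"
proof -
  have "green t s / (s * (T - s)) \<in> {profile t..C}" if s: "s \<in> {0<..<T}" for s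
    using green_bounds[OF t, of s] s by (simp add: profile_def le_divide_eq divide_le_eq)
  then have "d j * (green t (midpoint_node T n j) / (midpoint_node T n j * (T - midpoint_node T n j)))
      \<in> {d j * profile t..d j * C}" if "j < n" for j
    using midpoint_node_interior[OF T_pos that] d unfolding atLeastAtMost_iff
    by (intro conjI mult_left_mono) auto
  then have "(\<Sum>j<n. d j * profile t) \<le> approx n d t" "approx n d t \<le> (\<Sum>j<n. d j * C)"
    unfolding approx_def by (intro sum_mono; simp)+
  then show ?thesis by (simp add: sum_distrib_right[symmetric]) (simp add: mult.commute)
qed

text \<open>The growth conditions at 0 concern positive arguments only, hence strict positivity at
  the nodes.\<close>

lemma approx_pos:
  assumes "\<forall>i. 0 \<le> d i" "t \<in> {0<..<T}" "0 < (\<Sum>j<n. d j)"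
  shows "approx n d t \<in> {0<..C * (\<Sum>j<n. d j)}"
proof -
  have "0 < profile t * (\<Sum>j<n. d j)"
    using assms profile_pos by (intro mult_pos_pos) auto
  then show ?thesis using approx_bounds[OF assms(1), of t n] assms(2) by auto
qed

text \<open>\<open>f\<close> is estimated at the largest argument \<open>C * \<rho>\<close>. The
  slope makes the linear part contribute exactly \<open>\<rho> / 2\<close>, and the constant
  \<open>K\<close> contributes less than the other half; \<open>mass + 1\<close> leaves room for the
  quadrature error.\<close>

lemma sum_step_less:
  assumes d: "\<forall>i. 0 \<le> d i" and \<rho>: "(\<Sum>j<n. d j) = \<rho>" "0 < \<rho>"
    and mass: "midpoint_sum T n weight \<le> mass + 1"
    and f: "\<And>x. x \<in> {0<..C * \<rho>} \<Longrightarrow> f x \<le> 1 / (2 * (mass + 1) * C) * x + K"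
    and K: "0 \<le> K" "2 * (mass + 1) * K < \<rho>"
  shows "(\<Sum>i<n. step n d i) < \<rho>"
proof -
  define e where "e = 1 / (2 * (mass + 1) * C)"
  have e: "0 \<le> e" using mass_nonneg C_pos by (simp add: e_def)
  have "(mass + 1) * C * e = 1 / 2" using mass_nonneg C_pos by (simp add: e_def)
  then have "((mass + 1) * C * e) * \<rho> = \<rho> / 2" by simp
  then have half: "(mass + 1) * (e * (C * \<rho>)) = \<rho> / 2" by (simp only: mult_ac)
  \<comment> \<open>The summand \<open>0 * weight s\<close> only gives the integrand the shape of
    \<open>midpoint_sum_linear\<close>.\<close>
  have "(\<Sum>i<n. step n d i) \<le> midpoint_sum T n (\<lambda>s. (e * (C * \<rho>) + K) * weight s + 0 * weight s)"
    unfolding sum_step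
  proof (rule midpoint_sum_mono[OF T_pos])
    fix s assume s: "s \<in> {0<..<T}"
    have u: "approx n d s \<in> {0<..C * \<rho>}" using approx_pos[OF d s, of n] \<rho> by simp
    have "f (approx n d s) \<le> e * approx n d s + K" using f[OF u] by (simp add: e_def)
    also have "\<dots> \<le> e * (C * \<rho>) + K" using u e by (intro add_mono mult_left_mono) auto
    finally show "weight s * f (approx n d s) \<le> (e * (C * \<rho>) + K) * weight s + 0 * weight s"
      using weight_nonneg[of s] s by (simp add: mult.commute mult_left_mono)
  qed
  also have "\<dots> = (e * (C * \<rho>) + K) * midpoint_sum T n weight"
    by (subst midpoint_sum_linear) simp
  also have "\<dots> \<le> (e * (C * \<rho>) + K) * (mass + 1)"
    using e C_pos \<rho>(2) K(1) by (intro mult_left_mono mass) auto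
  also have "\<dots> = \<rho> / 2 + (mass + 1) * K" unfolding half[symmetric] by (simp add: algebra_simps)
  also have "\<dots> < \<rho>"
    using K(2) unfolding mult.assoc[of 2] by linarith
  finally show ?thesis .
qed

text \<open>In the constant 4, one factor 2 makes up for keeping only \<open>kappa / 2\<close> in
  the quadrature; the other produces \<open>2 * \<rho>\<close>, of which the shift \<open>U\<close>
  takes away less than \<open>\<rho>\<close>.\<close>

lemma sum_step_greater:
  assumes d: "\<forall>i. 0 \<le> d i" and \<rho>: "(\<Sum>j<n. d j) = \<rho>" "0 < \<rho>"
    and mass: "midpoint_sum T n weight \<le> mass + 1"
    and kappa: "kappa / 2 \<le> midpoint_sum T n (\<lambda>s. weight s * profile s)"
    and f: "\<And>x. x \<in> {0<..C * \<rho>} \<Longrightarrow> 4 / kappa * (x - U) \<le> f x"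
    and U: "0 \<le> U" "4 / kappa * (U * (mass + 1)) < \<rho>"
  shows "\<rho> < (\<Sum>i<n. step n d i)"
proof -
  define M where "M = 4 / kappa"
  have M: "0 < M" "M * \<rho> * (kappa / 2) = 2 * \<rho>" using kappa_pos by (auto simp: M_def)
  have "\<rho> < 2 * \<rho> - M * (U * (mass + 1))" using U(2) by (simp add: M_def)
  also have "\<dots> = M * \<rho> * (kappa / 2) - M * U * (mass + 1)" using M(2) by simp
  also have "\<dots> \<le> M * \<rho> * midpoint_sum T n (\<lambda>s. weight s * profile s) - M * U * midpoint_sum T n weight"
    using M(1) \<rho>(2) U(1) by (intro diff_mono mult_left_mono mass kappa) auto
  also have "\<dots> = midpoint_sum T n (\<lambda>s. M * \<rho> * (weight s * profile s) + (- (M * U)) * weight s)"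
    by (subst midpoint_sum_linear) simp
  also have "\<dots> \<le> (\<Sum>i<n. step n d i)"
    unfolding sum_step
  proof (rule midpoint_sum_mono[OF T_pos])
    fix s assume s: "s \<in> {0<..<T}"
    have u: "approx n d s \<in> {0<..C * \<rho>}" using approx_pos[OF d s, of n] \<rho> by simp
    have "profile s * \<rho> \<le> approx n d s" using approx_bounds[OF d, of s n] s \<rho> by simp
    then have "M * (profile s * \<rho> - U) \<le> M * (approx n d s - U)" using M(1) by simp
    also have "\<dots> \<le> f (approx n d s)" using f[OF u] by (simp add: M_def)
    finally have "weight s * (M * (profile s * \<rho> - U)) \<le> weight s * f (approx n d s)"
      using weight_nonneg[of s] s by (intro mult_left_mono) auto
    then show "M * \<rho> * (weight s * profile s) + (- (M * U)) * weight s \<le> weight s * f (approx n d s)"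
      by (simp add: algebra_simps)
  qed
  finally show ?thesis .
qed

lemma step_nonneg:
  assumes "\<forall>i. 0 \<le> d i" "i < n"
  shows "0 \<le> step n d i"
proof -
  have s: "midpoint_node T n i \<in> {0..T}" using midpoint_node_interior[OF T_pos assms(2)] by auto
  have "0 \<le> profile (midpoint_node T n i) * (\<Sum>j<n. d j)"
    using assms(1) s by (intro mult_nonneg_nonneg sum_nonneg profile_nonneg) auto
  then have "0 \<le> approx n d (midpoint_node T n i)" using approx_bounds[OF assms(1) s, of n] by simp
  then show ?thesis
    unfolding step_def using T_pos s by (intro mult_nonneg_nonneg weight_nonneg f_nonneg) auto
qed

lemma continuous_on_step:
  assumes "i < n"
  shows "continuous_on {d. \<forall>i. 0 \<le> d i} (\<lambda>d. step n d i)"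
proof -
  have s: "midpoint_node T n i \<in> {0..T}" using midpoint_node_interior[OF T_pos assms] by auto
  have coord: "continuous_on {d. \<forall>i. 0 \<le> d i} (\<lambda>d :: nat \<Rightarrow> real. d j)" for j
    by (rule continuous_on_subset[OF continuous_on_product_coordinates]) auto
  have "continuous_on {d. \<forall>i. 0 \<le> d i} (\<lambda>d. approx n d (midpoint_node T n i))"
    unfolding approx_def by (intro continuous_intros coord)
  then have "continuous_on {d. \<forall>i. 0 \<le> d i} (\<lambda>d. f (approx n d (midpoint_node T n i)))"
  proof (rule continuous_on_compose2[OF cont_f])
    have "0 \<le> approx n d (midpoint_node T n i)" if "\<forall>i. 0 \<le> d i" for d
    proof -
      have "0 \<le> profile (midpoint_node T n i) * (\<Sum>j<n. d j)"
        using that s by (intro mult_nonneg_nonneg sum_nonneg profile_nonneg) auto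
      then show ?thesis using approx_bounds[OF that s, of n] by simp
    qed
    then show "(\<lambda>d. approx n d (midpoint_node T n i)) ` {d. \<forall>i. 0 \<le> d i} \<subseteq> {0..}" by auto
  qed
  then show ?thesis unfolding step_def by (intro continuous_intros)
qed

lemma discrete_solutions:
  assumes lim: "(((\<lambda>x. f x / x) \<longlongrightarrow> 0) (at_right 0) \<and> filterlim (\<lambda>x. f x / x) at_top at_top)
       \<or> (filterlim (\<lambda>x. f x / x) at_top (at_right 0) \<and> ((\<lambda>x. f x / x) \<longlongrightarrow> 0) at_top)"
  obtains r R N where "0 < r"
    "\<And>n. N \<le> n \<Longrightarrow> \<exists>d. (\<forall>i. 0 \<le> d i) \<and> r \<le> (\<Sum>i<n. d i) \<and> (\<Sum>i<n. d i) \<le> R \<and> (\<forall>i<n. step n d i = d i)"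
proof -
  define e where "e = 1 / (2 * (mass + 1) * C)"
  define M where "M = 4 / kappa"
  have e: "0 < e" using mass_nonneg C_pos by (simp add: e_def)
  have M: "0 \<le> M" using kappa_pos by (simp add: M_def)
  \<comment> \<open>\<open>up\<close> and \<open>lo\<close> are the conditions on \<open>f\<close>
    under which the operator lowers, respectively raises, the size \<open>\<rho>\<close>.\<close>
  define up where "up \<rho> \<longleftrightarrow> (\<exists>K\<ge>0. 2 * (mass + 1) * K < \<rho> \<and> (\<forall>x\<in>{0<..C * \<rho>}. f x \<le> e * x + K))" for \<rho>
  define lo where "lo \<rho> \<longleftrightarrow> (\<exists>U\<ge>0. M * (U * (mass + 1)) < \<rho> \<and> (\<forall>x\<in>{0<..C * \<rho>}. M * (x - U) \<le> f x))" for \<rho>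
  obtain r R where rR: "0 < r" "r < R" "(up r \<and> lo R) \<or> (lo r \<and> up R)"
    using lim
  proof
    assume *: "((\<lambda>x. f x / x) \<longlongrightarrow> 0) (at_right 0) \<and> filterlim (\<lambda>x. f x / x) at_top at_top"
    obtain \<delta> where \<delta>: "0 < \<delta>" "\<And>x. x \<in> {0<..\<delta>} \<Longrightarrow> f x \<le> e * x"
      using sublinear_at_0_bound[of f e] * e by blast
    obtain U where U: "0 \<le> U" "\<And>x. 0 \<le> x \<Longrightarrow> M * (x - U) \<le> f x"
      using superlinear_at_top_bound[of f M] * M f_nonneg by blast
    \<comment> \<open>At size \<open>\<delta> / C\<close> all arguments of \<open>f\<close> are at
      most \<open>\<delta>\<close>, so the correction is 0. The large size exceeds both this one and
      the threshold set by \<open>U\<close>.\<close>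
    have "up (\<delta> / C)" unfolding up_def using \<delta> C_pos by (intro exI[of _ 0]) auto
    moreover have "lo (max (\<delta> / C) (M * (U * (mass + 1))) + 1)"
      unfolding lo_def using U by (intro exI[of _ U]) auto
    ultimately show thesis
      using that[of "\<delta> / C" "max (\<delta> / C) (M * (U * (mass + 1))) + 1"] \<delta>(1) C_pos by auto
  next
    assume *: "filterlim (\<lambda>x. f x / x) at_top (at_right 0) \<and> ((\<lambda>x. f x / x) \<longlongrightarrow> 0) at_top"
    obtain \<delta> where \<delta>: "0 < \<delta>" "\<And>x. x \<in> {0<..\<delta>} \<Longrightarrow> M * x \<le> f x"
      using superlinear_at_0_bound[of f M] * by blast
    obtain K where K: "0 \<le> K" "\<And>x. 0 \<le> x \<Longrightarrow> f x \<le> e * x + K"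
      using sublinear_at_top_bound[of f e] * e cont_f by blast
    have "lo (\<delta> / C)" unfolding lo_def using \<delta> C_pos by (intro exI[of _ 0]) auto
    moreover have "up (max (\<delta> / C) (2 * (mass + 1) * K) + 1)"
      unfolding up_def using K by (intro exI[of _ K]) auto
    ultimately show thesis
      using that[of "\<delta> / C" "max (\<delta> / C) (2 * (mass + 1) * K) + 1"] \<delta>(1) C_pos by auto
  qed
  have "\<forall>\<^sub>F n in sequentially. midpoint_sum T n weight < mass + 1"
    using midpoint_sum_tendsto[OF T_pos continuous_on_weight]
    by (rule order_tendstoD) (simp add: mass_def)
  moreover have "\<forall>\<^sub>F n in sequentially. kappa / 2 < midpoint_sum T n (\<lambda>s. weight s * profile s)"
  proof (rule order_tendstoD)
    show "(\<lambda>n. midpoint_sum T n (\<lambda>s. weight s * profile s)) \<longlonglongrightarrow> kappa"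
      unfolding kappa_def
      by (intro midpoint_sum_tendsto T_pos continuous_intros continuous_on_weight continuous_on_profile)
  qed (use kappa_pos in simp)
  ultimately have "\<forall>\<^sub>F n in sequentially. midpoint_sum T n weight < mass + 1 \<and>
      kappa / 2 < midpoint_sum T n (\<lambda>s. weight s * profile s)"
    by (rule eventually_conj)
  then obtain N where N: "\<And>n. N \<le> n \<Longrightarrow> midpoint_sum T n weight < mass + 1 \<and>
      kappa / 2 < midpoint_sum T n (\<lambda>s. weight s * profile s)"
    unfolding eventually_sequentially by blast
  show thesis
  \<comment> \<open>\<open>Suc N\<close> guarantees at least one node.\<close>
  proof (rule that[of r "Suc N" R])
    fix n assume n: "Suc N \<le> n"
    then have Nn: "midpoint_sum T n weight \<le> mass + 1"
        "kappa / 2 \<le> midpoint_sum T n (\<lambda>s. weight s * profile s)"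
      using N[of n] by auto
    have up: "(\<Sum>i<n. step n d i) < \<rho>" if "up \<rho>" "\<forall>i. 0 \<le> d i" "(\<Sum>i<n. d i) = \<rho>" "0 < \<rho>" for d \<rho>
      using that(1) sum_step_less[OF that(2,3,4) Nn(1)] unfolding up_def e_def by blast
    have lo: "\<rho> < (\<Sum>i<n. step n d i)" if "lo \<rho>" "\<forall>i. 0 \<le> d i" "(\<Sum>i<n. d i) = \<rho>" "0 < \<rho>" for d \<rho>
      using that(1) sum_step_greater[OF that(2,3,4) Nn] unfolding lo_def M_def by blast
    have R: "0 < R" using rR by linarith
    show "\<exists>d. (\<forall>i. 0 \<le> d i) \<and> r \<le> (\<Sum>i<n. d i) \<and> (\<Sum>i<n. d i) \<le> R \<and> (\<forall>i<n. step n d i = d i)"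
    proof (rule cone_fixed_point_finite[of n r R "step n"])
      show "0 < n" using n by simp
      show "((\<forall>x. (\<forall>i. 0 \<le> x i) \<and> (\<Sum>i<n. x i) = r \<longrightarrow> (\<Sum>i<n. step n x i) < r) \<and>
              (\<forall>x. (\<forall>i. 0 \<le> x i) \<and> (\<Sum>i<n. x i) = R \<longrightarrow> R < (\<Sum>i<n. step n x i))) \<or>
             ((\<forall>x. (\<forall>i. 0 \<le> x i) \<and> (\<Sum>i<n. x i) = r \<longrightarrow> r < (\<Sum>i<n. step n x i)) \<and>
              (\<forall>x. (\<forall>i. 0 \<le> x i) \<and> (\<Sum>i<n. x i) = R \<longrightarrow> (\<Sum>i<n. step n x i) < R))"
        using rR(3)
      proof
        assume "up r \<and> lo R"
        then show ?thesis using up[of r] lo[of R] rR(1) R by (intro disjI1) blast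
      next
        assume "lo r \<and> up R"
        then show ?thesis using lo[of r] up[of R] rR(1) R by (intro disjI2) blast
      qed
    qed (use rR(1,2) continuous_on_step step_nonneg in auto)
  qed (use rR in auto)
qed

end

section \<open>Passage to the limit\<close>

context nonlinear_bvp
begin

section \<open>Properties of the discrete solutions\<close>

lemma continuous_on_approx: "continuous_on S (approx n d)"
  unfolding approx_def divide_inverse by (intro continuous_intros continuous_on_green)

text \<open>The boundary conditions hold exactly on every mesh, as each \<open>green t s\<close>
  satisfies them in \<open>t\<close>; later they need only a limit.\<close>

lemma approx_boundary_left: "approx n d 0 = \<beta> * approx n d \<eta>"
proof -
  have "green 0 (midpoint_node T n j) = \<beta> * green \<eta> (midpoint_node T n j)" if "j < n" for j
    using midpoint_node_interior[OF T_pos that] by (intro green_boundary_left) auto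
  then show ?thesis
    unfolding approx_def sum_distrib_left by (intro sum.cong refl) (simp add: mult_ac)
qed

lemma approx_boundary_right: "approx n d T = \<alpha> * integral {0..\<eta>} (approx n d)"
proof -
  define v where "v j = d j / (midpoint_node T n j * (T - midpoint_node T n j))" for j
  have approx: "approx n d t = (\<Sum>j<n. v j * green t (midpoint_node T n j))" for t
    by (simp add: approx_def v_def)
  have "integral {0..\<eta>} (approx n d)
      = (\<Sum>j<n. integral {0..\<eta>} (\<lambda>t. v j * green t (midpoint_node T n j)))"
    unfolding approx[abs_def]
    by (rule integral_sum)
       (auto intro!: integrable_continuous_real continuous_intros continuous_on_green)
  also have "\<alpha> * \<dots> = (\<Sum>j<n. v j * (\<alpha> * integral {0..\<eta>} (\<lambda>t. green t (midpoint_node T n j))))"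
    by (simp add: sum_distrib_left mult_ac)
  also have "\<dots> = approx n d T"
    unfolding approx
  proof (rule sum.cong)
    fix j assume "j \<in> {..<n}"
    then have "midpoint_node T n j \<in> {0..T}" using midpoint_node_interior[OF T_pos, of j n] by auto
    then show "v j * (\<alpha> * integral {0..\<eta>} (\<lambda>t. green t (midpoint_node T n j))) = v j * green T (midpoint_node T n j)"
      by (simp add: green_boundary_right)
  qed simp
  finally show ?thesis by simp
qed

text \<open>At a fixed point the factor \<open>s * (T - s)\<close> contained in \<open>d j\<close>
  cancels the denominator in \<open>approx\<close>. The identity holds at all \<open>t\<close>, not
  just at nodes, as in Nystrom's method.\<close>

lemma approx_fixed:
  assumes "\<forall>i<n. step n d i = d i"
  shows "approx n d t = midpoint_sum T n (\<lambda>s. green t s * (a s * f (approx n d s)))"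
  unfolding midpoint_sum_def sum_distrib_left
  unfolding approx_def[of n d t]
proof (rule sum.cong)
  fix j assume "j \<in> {..<n}"
  then have j: "j < n" by simp
  define s where "s = midpoint_node T n j"
  define w where "w = s * (T - s)"
  have "0 < w" using midpoint_node_interior[OF T_pos j] by (simp add: w_def s_def)
  moreover have "d j = T / n * (a s * w * f (approx n d s))"
    using assms j by (auto simp: step_def weight_def s_def w_def)
  ultimately have "d j * (green t s / (s * (T - s))) = T / n * (green t s * (a s * f (approx n d s)))"
    unfolding w_def[symmetric] by simp
  then show "d j * (green t (midpoint_node T n j) / (midpoint_node T n j * (T - midpoint_node T n j)))
      = T / n * (green t (midpoint_node T n j) * (a (midpoint_node T n j) * f (approx n d (midpoint_node T n j))))"
    unfolding s_def .
qed simp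

text \<open>The affine part of the kernel is absorbed into the boundary values of
  \<open>approx\<close>, which converge by themselves. The limit of the remaining sum then rests on
  continuity of \<open>dirichlet_green\<close> in \<open>s\<close>.\<close>

lemma approx_split:
  assumes "\<forall>i<n. step n d i = d i"
  shows "approx n d t = midpoint_sum T n (\<lambda>s. dirichlet_green T t s * (a s * f (approx n d s)))
    + approx n d 0 * (1 - t / T) + approx n d T * (t / T)"
proof -
  define y where "y s = a s * f (approx n d s)" for s
  have "green t s * y s = dirichlet_green T t s * y s
      + ((1 - t / T) * (green 0 s * y s) + (t / T) * (green T s * y s))" if "s \<in> {0<..<T}" for s
    using green_0[of s] green_T[of s] that by (simp add: green_def algebra_simps)
  \<comment> \<open>The pointwise identity is known on the open interval, which contains all nodes;
    monotonicity in both directions turns it into equality of the sums.\<close>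
  then have "midpoint_sum T n (\<lambda>s. green t s * y s)
      = midpoint_sum T n (\<lambda>s. 1 * (dirichlet_green T t s * y s)
        + 1 * ((1 - t / T) * (green 0 s * y s) + (t / T) * (green T s * y s)))"
    by (intro antisym midpoint_sum_mono T_pos) auto
  then show ?thesis
    unfolding midpoint_sum_linear y_def
    unfolding approx_fixed[OF assms, symmetric] by simp
qed

text \<open>This supplies equicontinuity: the constant depends on the mesh only through
  \<open>Y\<close>.\<close>

lemma approx_lipschitz:
  assumes "\<forall>i<n. step n d i = d i" and Y: "\<And>s. s \<in> {0<..<T} \<Longrightarrow> \<bar>a s * f (approx n d s)\<bar> \<le> Y"
  shows "\<bar>approx n d t - approx n d t'\<bar> \<le> T * L * Y * \<bar>t - t'\<bar>"
proof -
  define y where "y s = a s * f (approx n d s)" for s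
  have Y_nonneg: "0 \<le> Y" using Y[of "T/2"] T_pos by auto
  have "\<bar>\<Sum>i<n. (green t (midpoint_node T n i) - green t' (midpoint_node T n i)) * y (midpoint_node T n i)\<bar>
      \<le> (\<Sum>i<n. L * \<bar>t - t'\<bar> * Y)"
  proof (rule order_trans[OF sum_abs sum_mono])
    fix i assume "i \<in> {..<n}"
    then have s: "midpoint_node T n i \<in> {0<..<T}" using midpoint_node_interior[OF T_pos] by simp
    then show "\<bar>(green t (midpoint_node T n i) - green t' (midpoint_node T n i)) * y (midpoint_node T n i)\<bar>
        \<le> L * \<bar>t - t'\<bar> * Y"
      unfolding abs_mult using Y[OF s, folded y_def] L_nonneg
      by (intro mult_mono green_lipschitz) auto
  qed
  then have "T / n * \<bar>\<Sum>i<n. (green t (midpoint_node T n i) - green t' (midpoint_node T n i)) * y (midpoint_node T n i)\<bar>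
      \<le> T / n * (\<Sum>i<n. L * \<bar>t - t'\<bar> * Y)"
    using T_pos by (intro mult_left_mono) auto
  also have "\<dots> \<le> T * L * Y * \<bar>t - t'\<bar>"
    using T_pos L_nonneg Y_nonneg by (cases "n = 0") (auto simp: mult_ac)
  also have "T / n * \<bar>\<Sum>i<n. (green t (midpoint_node T n i) - green t' (midpoint_node T n i)) * y (midpoint_node T n i)\<bar>
      = \<bar>midpoint_sum T n (\<lambda>s. 1 * (green t s * y s) + (-1) * (green t' s * y s))\<bar>"
    using T_pos by (simp add: midpoint_sum_def abs_mult left_diff_distrib)
  also have "midpoint_sum T n (\<lambda>s. 1 * (green t s * y s) + (-1) * (green t' s * y s)) = approx n d t - approx n d t'"
    unfolding midpoint_sum_linear y_def unfolding approx_fixed[OF assms(1), symmetric] by simp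
  finally show ?thesis .
qed

lemma positive_solution_of_discrete:
  assumes r: "0 < r"
    and ex: "\<And>n. N \<le> n \<Longrightarrow> \<exists>d. (\<forall>i. 0 \<le> d i) \<and> r \<le> (\<Sum>i<n. d i) \<and> (\<Sum>i<n. d i) \<le> R \<and> (\<forall>i<n. step n d i = d i)"
  shows "\<exists>u. is_solution T \<eta> \<alpha> \<beta> a f u \<and> (\<forall>t\<in>{0<..<T}. u t > 0)"
proof -
  \<comment> \<open>Indices are shifted by \<open>N\<close> so that every term of the sequence
    exists.\<close>
  obtain d where d: "\<And>n. \<forall>i. 0 \<le> d n i" "\<And>n. r \<le> (\<Sum>i<n + N. d n i)" "\<And>n. (\<Sum>i<n + N. d n i) \<le> R"
    "\<And>n. \<forall>i<n + N. step (n + N) (d n) i = d n i"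
    using ex[OF le_add2] by metis
  define U where "U n = approx (n + N) (d n)" for n
  define B where "B = C * R"
  have U_bounds: "U n t \<in> {profile t * r..B}" if t: "t \<in> {0..T}" for n t
  proof -
    have "approx (n + N) (d n) t \<in> {profile t * (\<Sum>i<n + N. d n i)..C * (\<Sum>i<n + N. d n i)}"
      by (rule approx_bounds[OF d(1) t])
    moreover have "profile t * r \<le> profile t * (\<Sum>i<n + N. d n i)"
      by (intro mult_left_mono d(2) profile_nonneg t)
    moreover have "C * (\<Sum>i<n + N. d n i) \<le> B"
      unfolding B_def using C_pos by (intro mult_left_mono d(3)) auto
    ultimately show ?thesis by (auto simp: U_def)
  qed
  have U_range: "U n t \<in> {0..B}" if t: "t \<in> {0..T}" for n t
  proof -
    have "0 \<le> profile t * r" using profile_nonneg[OF t] r by simp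
    then show ?thesis using U_bounds[OF t, of n] by auto
  qed
  have cont_fB: "continuous_on {0..B} f" by (rule continuous_on_subset[OF cont_f]) auto
  obtain Fb where Fb: "\<And>x. x \<in> {0..B} \<Longrightarrow> \<bar>f x\<bar> \<le> Fb"
    by (rule continuous_on_Icc_abs_bound[OF cont_fB]) blast
  obtain Ab where Ab: "0 \<le> Ab" "\<And>x. x \<in> {0..T} \<Longrightarrow> \<bar>a x\<bar> \<le> Ab"
    by (rule continuous_on_Icc_abs_bound[OF cont_a]) blast
  define K where "K = T * L * (Ab * Fb)"
  have U_lipschitz: "\<bar>U n t - U n t'\<bar> \<le> K * \<bar>t - t'\<bar>" for n t t'
    unfolding U_def K_def
  proof (rule approx_lipschitz[OF d(4)])
    fix s assume "s \<in> {0<..<T}"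
    then have s: "s \<in> {0..T}" by auto
    show "\<bar>a s * f (approx (n + N) (d n) s)\<bar> \<le> Ab * Fb"
      unfolding abs_mult using Ab(1) Ab(2)[OF s] Fb[OF U_range[OF s, of n]]
      by (intro mult_mono) (auto simp: U_def)
  qed
  \<comment> \<open>The denominator \<open>\<bar>K\<bar> + 1\<close> keeps the modulus of continuity
    positive and finite also for \<open>K = 0\<close>.\<close>
  have "\<exists>e'>0. \<forall>n y. y \<in> {0..T} \<and> norm (x - y) < e' \<longrightarrow> norm (U n x - U n y) < e"
    if "0 < e" for x e
  proof (intro exI[of _ "e / (\<bar>K\<bar> + 1)"] conjI allI impI)
    fix n y assume "y \<in> {0..T} \<and> norm (x - y) < e / (\<bar>K\<bar> + 1)"
    then have "(\<bar>K\<bar> + 1) * \<bar>x - y\<bar> < e" by (simp add: less_divide_eq mult.commute add_nonneg_pos)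
    moreover have "K * \<bar>x - y\<bar> \<le> (\<bar>K\<bar> + 1) * \<bar>x - y\<bar>" by (intro mult_right_mono) auto
    ultimately show "norm (U n x - U n y) < e" using U_lipschitz[of n x y] by simp
  qed (use that in simp)
  moreover have "norm (U n x) \<le> B" if "x \<in> {0..T}" for n x using U_range[OF that, of n] by simp
  ultimately obtain u k where cont_u: "continuous_on {0..T} u" and k: "strict_mono (k :: nat \<Rightarrow> nat)"
    and conv: "\<And>e. 0 < e \<Longrightarrow> \<exists>M. \<forall>n x. n \<ge> M \<and> x \<in> {0..T} \<longrightarrow> norm (U (k n) x - u x) < e"
    using Arzela_Ascoli[of "{0..T}" U B] compact_Icc by (metis (no_types, lifting))
  have unif: "uniform_limit {0..T} (\<lambda>n. U (k n)) u sequentially"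
    unfolding uniform_limit_sequentially_iff dist_norm using conv by blast
  have lim: "(\<lambda>n. U (k n) t) \<longlonglongrightarrow> u t" if "t \<in> {0..T}" for t
    by (rule tendsto_uniform_limitI[OF unif that])
  have u_range: "u t \<in> {0..B}" if t: "t \<in> {0..T}" for t
    by (rule Lim_in_closed_set[OF _ _ _ lim[OF t]]) (use U_range[OF t] in auto)
  have u_lower: "profile t * r \<le> u t" if t: "t \<in> {0..T}" for t
    by (rule LIMSEQ_le_const[OF lim[OF t]]) (use U_bounds[OF t] in auto)
  define y where "y s = a s * f (u s)" for s
  \<comment> \<open>All values lie in \<open>{0..B}\<close>, where \<open>f\<close> is uniformly
    continuous, so uniform convergence survives the composition.\<close>
  have unif_f: "uniform_limit {0..T} (\<lambda>n s. f (U (k n) s)) (\<lambda>s. f (u s)) sequentially"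
    by (rule uniform_limit_compose_uniformly_continuous_on[OF unif compact_uniformly_continuous[OF cont_fB]])
       (use U_range in auto)
  have cont_fu: "continuous_on {0..T} (\<lambda>s. f (u s))"
    by (rule continuous_on_compose2[OF cont_fB cont_u]) (use u_range in auto)
  have cont_y: "continuous_on {0..T} y"
    unfolding y_def by (intro continuous_intros cont_a cont_fu)
  have bounded_cont: "bounded (g ` {0..T})" if "continuous_on {0..T} g" for g :: "real \<Rightarrow> real"
    by (intro compact_imp_bounded compact_continuous_image that compact_Icc)
  have Nk: "filterlim (\<lambda>n. k n + N) at_top sequentially"
    by (rule filterlim_at_top_mono[OF filterlim_subseq[OF k]]) auto
  \<comment> \<open>The limit solves the integral equation with its own boundary values as affine
    data; this gives regularity and the differential equation, while the boundary conditions are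
    passed to the limit separately.\<close>
  have u_eq: "u t = integral {0..T} (\<lambda>s. dirichlet_green T t s * y s) + u 0 * (1 - t / T) + u T * (t / T)"
    if t: "t \<in> {0..T}" for t
  proof -
    have cont_g: "continuous_on {0..T} (\<lambda>s. dirichlet_green T t s * a s)"
      unfolding dirichlet_green_def using T_pos by (intro continuous_intros cont_a) auto
    have "uniform_limit {0..T} (\<lambda>n s. dirichlet_green T t s * a s * f (U (k n) s))
        (\<lambda>s. dirichlet_green T t s * a s * f (u s)) sequentially"
      by (rule uniform_lim_mult[OF uniform_limit_const unif_f bounded_cont[OF cont_g] bounded_cont[OF cont_fu]])
    then have "(\<lambda>n. midpoint_sum T (k n + N) (\<lambda>s. dirichlet_green T t s * a s * f (U (k n) s)))
        \<longlonglongrightarrow> integral {0..T} (\<lambda>s. dirichlet_green T t s * a s * f (u s))"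
      by (intro midpoint_sum_tendsto_uniform T_pos Nk continuous_intros cont_g cont_fu)
    then have "(\<lambda>n. midpoint_sum T (k n + N) (\<lambda>s. dirichlet_green T t s * a s * f (U (k n) s))
          + U (k n) 0 * (1 - t / T) + U (k n) T * (t / T))
        \<longlonglongrightarrow> integral {0..T} (\<lambda>s. dirichlet_green T t s * a s * f (u s)) + u 0 * (1 - t / T) + u T * (t / T)"
      using T_pos by (intro tendsto_intros lim) auto
    also have "(\<lambda>n. midpoint_sum T (k n + N) (\<lambda>s. dirichlet_green T t s * a s * f (U (k n) s))
          + U (k n) 0 * (1 - t / T) + U (k n) T * (t / T)) = (\<lambda>n. U (k n) t)"
    proof
      fix n
      show "midpoint_sum T (k n + N) (\<lambda>s. dirichlet_green T t s * a s * f (U (k n) s))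
          + U (k n) 0 * (1 - t / T) + U (k n) T * (t / T) = U (k n) t"
        unfolding U_def mult.assoc[of _ "a _"] by (rule approx_split[OF d(4), symmetric])
    qed
    finally show ?thesis
      using LIMSEQ_unique[OF lim[OF t]] by (simp add: y_def mult.assoc)
  qed
  obtain u' where "C2_on T u u' (\<lambda>t. - y t)"
    using C2_on_dirichlet_green[OF T_pos cont_y u_eq] by blast
  then have "C2_on T u u' (\<lambda>t. - y t) \<and> (\<forall>t\<in>{0<..<T}. - y t + a t * f (u t) = 0)"
    by (simp add: y_def)
  then have "\<exists>u' u''. C2_on T u u' u'' \<and> (\<forall>t\<in>{0<..<T}. u'' t + a t * f (u t) = 0)"
    by - (rule exI[of _ u'], rule exI[of _ "\<lambda>t. - y t"])
  moreover have "u 0 = \<beta> * u \<eta>"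
  proof (rule LIMSEQ_unique)
    show "(\<lambda>n. U (k n) 0) \<longlonglongrightarrow> u 0" using T_pos by (intro lim) auto
    show "(\<lambda>n. U (k n) 0) \<longlonglongrightarrow> \<beta> * u \<eta>"
      unfolding U_def approx_boundary_left unfolding U_def[symmetric]
      using \<eta>_pos \<eta>_less by (intro tendsto_intros lim) auto
  qed
  moreover have "u T = \<alpha> * integral {0..\<eta>} u"
  proof (rule LIMSEQ_unique)
    show "(\<lambda>n. U (k n) T) \<longlonglongrightarrow> u T" using T_pos by (intro lim) auto
    have "uniform_limit {0..\<eta>} (\<lambda>n. U (k n)) u sequentially"
      by (rule uniform_limit_on_subset[OF unif]) (use \<eta>_less in auto)
    then obtain I J where IJ: "\<And>n. (U (k n) has_integral I n) {0..\<eta>}" "(u has_integral J) {0..\<eta>}" "I \<longlonglongrightarrow> J"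
      by (rule uniform_limit_integral) (auto simp: U_def intro: continuous_on_approx)
    have "I = (\<lambda>n. integral {0..\<eta>} (U (k n)))" "J = integral {0..\<eta>} u"
      using IJ(1)[THEN integral_unique] IJ(2)[THEN integral_unique] by (simp_all add: fun_eq_iff)
    then have "(\<lambda>n. \<alpha> * integral {0..\<eta>} (U (k n))) \<longlonglongrightarrow> \<alpha> * integral {0..\<eta>} u"
      using tendsto_mult_left[OF IJ(3), of \<alpha>] by simp
    then show "(\<lambda>n. U (k n) T) \<longlonglongrightarrow> \<alpha> * integral {0..\<eta>} u"
      unfolding U_def approx_boundary_right .
  qed
  moreover have "\<forall>t\<in>{0<..<T}. u t > 0"
  proof
    fix t assume t: "t \<in> {0<..<T}"
    have "0 < profile t * r" by (intro mult_pos_pos profile_pos t r)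
    then show "u t > 0" using u_lower[of t] t by auto
  qed
  ultimately show ?thesis
    unfolding is_solution_def by blast
qed

end

theorem theorem3p1:
  fixes T \<eta> \<alpha> \<beta> :: real and f a :: "real \<Rightarrow> real"
  assumes "T > 0" and "0 < \<eta>" and "\<eta> < T"
    and "0 < \<alpha>" and "\<alpha> < 2 * T / \<eta>^2"
    and "0 \<le> \<beta>" and "\<beta> < (2 * T - \<alpha> * \<eta>^2) / (\<alpha> * \<eta>^2 - 2 * \<eta> + 2 * T)"
    and "continuous_on {0..} f" and "\<forall>x\<ge>0. f x \<ge> 0"
    and "continuous_on {0..T} a" and "\<forall>t\<in>{0..T}. a t \<ge> 0"
    and "\<exists>t0\<in>{\<eta>..T}. a t0 > 0"
    and "(((\<lambda>x. f x / x) \<longlongrightarrow> 0) (at_right 0) \<and> filterlim (\<lambda>x. f x / x) at_top at_top)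
       \<or> (filterlim (\<lambda>x. f x / x) at_top (at_right 0) \<and> ((\<lambda>x. f x / x) \<longlongrightarrow> 0) at_top)"
  shows "\<exists>u. is_solution T \<eta> \<alpha> \<beta> a f u \<and> (\<forall>t\<in>{0<..<T}. u t > 0)"
proof -
  interpret integral_bvp T \<eta> \<alpha> \<beta> by unfold_locales (use assms in auto)
  obtain C L where CL: "0 < C" "0 \<le> L"
    "\<And>t s. t \<in> {0..T} \<Longrightarrow> s \<in> {0..T} \<Longrightarrow>
      green t s \<in> {min t (T - t) / T\<^sup>2 * (s * (T - s)) .. C * (s * (T - s))}"
    "\<And>t t' s. s \<in> {0..T} \<Longrightarrow> \<bar>green t s - green t' s\<bar> \<le> L * \<bar>t - t'\<bar>"
    by (rule green_estimates) blast
  have "\<exists>t\<in>{0..T}. 0 < a t" using assms(2,12) by force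
  then interpret nonlinear_bvp T \<eta> \<alpha> \<beta> a f C L
    by unfold_locales (use assms CL in auto)
  obtain r R N where "0 < r"
    "\<And>n. N \<le> n \<Longrightarrow> \<exists>d. (\<forall>i. 0 \<le> d i) \<and> r \<le> (\<Sum>i<n. d i) \<and> (\<Sum>i<n. d i) \<le> R \<and> (\<forall>i<n. step n d i = d i)"
    by (rule discrete_solutions[OF assms(13)]) blast
  then show ?thesis by (rule positive_solution_of_discrete)
qed

end
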